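(* Let $\hat{A},\hat{B} \in \mathbb{D}\mathbb{C}^{m \times m}$ be dual complex matrices such that $\hat{A}$ is invertible. If $$\hat{B}^N(\hat{A}\hat{B})\hat{B}^*=\hat{A}\hat{B}^*,$$ $$\hat{B}\hat{B}^N\hat{A}\hat{B}=\hat{A}\hat{B},$$ $$\hat{A}\hat{B}(\hat{A}\hat{B})^N\hat{B}=\hat{B},$$ then $(\hat{A}\hat{B})^N=\hat{A}^{-1}\hat{B}^N$.
   Context: A dual complex number is $\hat a=a_s+a_d\epsilon$ with $a_s,a_d\in\mathbb{C}$, where $\epsilon$ commutes with complex numbers and $\epsilon^2=0$; it is a dual number if $a_s,a_d\in\mathbb{R}$. A dual number is positive appreciable if $a_s>0$, and positive infinitesimal if $a_s=0$ and $a_d>0$. $\mathbb{D}\mathbb{C}^{m\times n}$ is the set of $m\times n$ dual complex matrices $\hat A=A_s+A_d\epsilon$, $A_s,A_d\in\mathbb{C}^{m\times n}$, and $\hat A^*=A_s^*+A_d^*\epsilon$ (conjugate transpose). $\hat U$ (square) is unitary if $\hat U^*\hat U=\hat U\hat U^*=I$. Known fact (SVD): every $\hat A\in\mathbb{D}\mathbb{C}^{m\times n}$ can be written $\hat A=\hat U\begin{bmatrix}\hat\Sigma_1&O\\O&\hat\Sigma_2\end{bmatrix}\hat V^*$ with $\hat U\in\mathbb{D}\mathbb{C}^{m\times m}$, $\hat V\in\mathbb{D}\mathbb{C}^{n\times n}$ unitary, $\hat\Sigma_1=\mathrm{diag}(\hat\mu_1,\dots,\hat\mu_r)$ with positive appreciable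 dual numbers on the diagonal, and $\hat\Sigma_2$ a (rectangular) diagonal matrix with diagonal entries that are positive infinitesimal dual numbers or zero. The essential part of $\hat A$ is $\hat A_e=\hat U\begin{bmatrix}\hat\Sigma_1&O\\O&O\end{bmatrix}\hat V^*$. The new dual Moore-Penrose inverse (NDMPI) $\hat A^N\in\mathbb{D}\mathbb{C}^{n\times m}$ of $\hat A$ is the unique $\hat X$ (known to exist for every $\hat A$) satisfying $\hat A\hat X\hat A=\hat A_e$, $\hat X\hat A\hat X=\hat X$, $(\hat A\hat X)^*=\hat A\hat X$, $(\hat X\hat A)^*=\hat X\hat A$; in terms of the SVD, $\hat A^N=\hat V\begin{bmatrix}\hat\Sigma_1^{-1}&O\\O&O\end{bmatrix}\hat U^*$. *)

theory Defs
  imports "Jordan_Normal_Form.Matrix" "Jordan_Normal_Form.Conjugate"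
begin

section \<open>Dual complex numbers\<close>

text \<open>\<open>DC a b\<close> represents \<open>a + b \<epsilon>\<close>, where \<open>\<epsilon>\<close> commutes with complex numbers and
  \<open>\<epsilon> * \<epsilon> = 0\<close>.\<close>

datatype dcomplex = DC (std_part: complex) (dual_part: complex)

instantiation dcomplex :: comm_ring_1
begin

definition zero_dcomplex :: dcomplex where
  "0 = DC 0 0"

definition one_dcomplex :: dcomplex where
  "1 = DC 1 0"

definition plus_dcomplex :: "dcomplex \<Rightarrow> dcomplex \<Rightarrow> dcomplex" where
  "x + y = DC (std_part x + std_part y) (dual_part x + dual_part y)"

definition uminus_dcomplex :: "dcomplex \<Rightarrow> dcomplex" where
  "- x = DC (- std_part x) (- dual_part x)"

definition minus_dcomplex :: "dcomplex \<Rightarrow> dcomplex \<Rightarrow> dcomplex" where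
  "x - y = DC (std_part x - std_part y) (dual_part x - dual_part y)"

definition times_dcomplex :: "dcomplex \<Rightarrow> dcomplex \<Rightarrow> dcomplex" where
  "x * y = DC (std_part x * std_part y) (std_part x * dual_part y + dual_part x * std_part y)"

instance
  by standard
    (auto simp: zero_dcomplex_def one_dcomplex_def plus_dcomplex_def uminus_dcomplex_def
      minus_dcomplex_def times_dcomplex_def algebra_simps intro: dcomplex.expand)

end

instantiation dcomplex :: conjugatable_ring
begin

definition conjugate_dcomplex :: "dcomplex \<Rightarrow> dcomplex" where
  "conjugate x = DC (cnj (std_part x)) (cnj (dual_part x))"

instance
  by standard
    (auto simp: conjugate_dcomplex_def zero_dcomplex_def plus_dcomplex_def
      uminus_dcomplex_def times_dcomplex_def dcomplex.expand)

end

definition is_dual_number :: "dcomplex \<Rightarrow> bool" where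
  "is_dual_number x \<longleftrightarrow> std_part x \<in> \<real> \<and> dual_part x \<in> \<real>"

definition positive_appreciable :: "dcomplex \<Rightarrow> bool" where
  "positive_appreciable x \<longleftrightarrow> is_dual_number x \<and> Re (std_part x) > 0"

definition positive_infinitesimal :: "dcomplex \<Rightarrow> bool" where
  "positive_infinitesimal x \<longleftrightarrow> is_dual_number x \<and> std_part x = 0 \<and> Re (dual_part x) > 0"

section \<open>Dual complex matrices\<close>

text \<open>A dual complex matrix \<open>A\<^sub>s + A\<^sub>d \<epsilon>\<close> is a matrix over the ring \<^typ>\<open>dcomplex\<close>. The library's
  \<open>mat_adjoint\<close> is restricted to fields, so the conjugate transpose is defined here.\<close>

type_synonym dcmat = "dcomplex mat"

definition dc_adjoint :: "dcmat \<Rightarrow> dcmat" where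
  "dc_adjoint A = map_mat conjugate (transpose_mat A)"

definition dc_unitary :: "dcmat \<Rightarrow> bool" where
  "dc_unitary U \<longleftrightarrow> square_mat U \<and>
     dc_adjoint U * U = 1\<^sub>m (dim_row U) \<and> U * dc_adjoint U = 1\<^sub>m (dim_row U)"

definition dc_inverse :: "dcmat \<Rightarrow> dcmat" where
  "dc_inverse A = (THE X. X \<in> carrier_mat (dim_col A) (dim_row A) \<and>
     inverts_mat A X \<and> inverts_mat X A)"

text \<open>The block sizes are forced by \<open>r = dim_row S1\<close>: \<open>S1\<close> is \<open>r \<times> r\<close> and \<open>S2\<close> is
  \<open>(m - r) \<times> (n - r)\<close>, possibly rectangular or empty.\<close>

definition is_dc_svd :: "dcmat \<Rightarrow> dcmat \<Rightarrow> dcmat \<Rightarrow> dcmat \<Rightarrow> dcmat \<Rightarrow> bool" where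
  "is_dc_svd A U S1 S2 V \<longleftrightarrow>
     (let m = dim_row A; n = dim_col A; r = dim_row S1 in
        r \<le> m \<and> r \<le> n \<and>
        U \<in> carrier_mat m m \<and> dc_unitary U \<and>
        V \<in> carrier_mat n n \<and> dc_unitary V \<and>
        S1 \<in> carrier_mat r r \<and> diagonal_mat S1 \<and>
        (\<forall>i<r. positive_appreciable (S1 $$ (i, i))) \<and>
        S2 \<in> carrier_mat (m - r) (n - r) \<and> diagonal_mat S2 \<and>
        (\<forall>i<min (m - r) (n - r). positive_infinitesimal (S2 $$ (i, i)) \<or> S2 $$ (i, i) = 0) \<and>
        A = U * four_block_mat S1 (0\<^sub>m r (n - r)) (0\<^sub>m (m - r) r) S2 * dc_adjoint V)"

definition is_essential_part :: "dcmat \<Rightarrow> dcmat \<Rightarrow> bool" where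
  "is_essential_part A E \<longleftrightarrow>
     (\<exists>U S1 S2 V. is_dc_svd A U S1 S2 V \<and>
        (let m = dim_row A; n = dim_col A; r = dim_row S1 in
           E = U * four_block_mat S1 (0\<^sub>m r (n - r)) (0\<^sub>m (m - r) r) (0\<^sub>m (m - r) (n - r))
                 * dc_adjoint V))"

text \<open>The essential part does not depend on the chosen SVD.\<close>

definition essential_part :: "dcmat \<Rightarrow> dcmat" where
  "essential_part A = (THE E. is_essential_part A E)"

definition is_ndmpi :: "dcmat \<Rightarrow> dcmat \<Rightarrow> bool" where
  "is_ndmpi A X \<longleftrightarrow>
     X \<in> carrier_mat (dim_col A) (dim_row A) \<and>
     A * X * A = essential_part A \<and>
     X * A * X = X \<and>
     dc_adjoint (A * X) = A * X \<and>
     dc_adjoint (X * A) = X * A"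

definition ndmpi :: "dcmat \<Rightarrow> dcmat" where
  "ndmpi A = (THE X. is_ndmpi A X)"

end

theory Submission
  imports Defs "Jordan_Normal_Form.Spectral_Radius"
begin

text \<open>
  Write \<open>C = A B\<close>, \<open>N = B\<^sup>N\<close> and \<open>M = C\<^sup>N\<close>. The second and third hypotheses say that the orthogonal
  projectors \<open>B N\<close> and \<open>C M\<close> absorb each other, so they coincide; hence \<open>C M C = C\<close>, that is, \<open>C\<close> is its
  own essential part. Multiplying the first hypothesis by \<open>N\<^sup>*\<close> gives \<open>N C = A R\<close> with \<open>R = N B\<close>, so \<open>A\<close>
  maps the range of the projector \<open>R\<close> into itself, and so does \<open>A\<^sup>-\<^sup>1\<close>. With this, the four defining
  equations for \<open>A\<^sup>-\<^sup>1 N\<close> are short computations.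

  These equations are available only once the NDMPI is known to exist, which rests on the dual SVD.
  It is obtained by perturbation theory: after a complex SVD \<open>S\<close> of the standard part, conjugation by \<open>I + K \<epsilon>\<close> and \<open>I + L \<epsilon>\<close> with \<open>K\<close>, \<open>L\<close> skew-Hermitian
  reduces the dual part \<open>G\<close> to Hermitian blocks commuting with \<open>S\<close> (and one arbitrary block where \<open>S\<close>
  vanishes). The former are diagonalised together with \<open>S\<close> by the spectral theorem for the normal matrix
  \<open>S + \<i> G\<close>, the latter by a complex SVD.
\<close>

section \<open>Adjoints and unitary equivalence over a ring with conjugation\<close>

text \<open>Agrees with \<open>dc_adjoint\<close> on dual complex matrices; in this polymorphic form
  the same lemmas serve complex and dual complex matrices.\<close>

definition adj :: "'a :: conjugatable_ring mat \<Rightarrow> 'a mat" where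
  "adj A = map_mat conjugate (transpose_mat A)"

lemma adj_carrier [simp]: "A \<in> carrier_mat n m \<Longrightarrow> adj A \<in> carrier_mat m n"
  by (auto simp: adj_def)

lemma dim_adj [simp]: "dim_row (adj A) = dim_col A" "dim_col (adj A) = dim_row A"
  by (auto simp: adj_def)

lemma index_adj [simp]: "i < dim_col A \<Longrightarrow> j < dim_row A \<Longrightarrow> adj A $$ (i, j) = conjugate (A $$ (j, i))"
  by (auto simp: adj_def)

lemma adj_adj [simp]: "adj (adj A) = A"
  by (rule eq_matI) auto

text \<open>Being multiplicative and involutive, conjugation sends \<open>conjugate 1 * 1\<close>
  both to \<open>1\<close> and to \<open>conjugate 1\<close>.\<close>

lemma conjugate_one [simp]: "conjugate (1 :: 'a :: {comm_ring_1, conjugatable_ring}) = 1"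
proof -
  have "conjugate (conjugate 1 * 1) = (conjugate 1 :: 'a)"
    by (simp only: conjugate_dist_mul conjugate_id mult_1_left)
  then show ?thesis by simp
qed

lemma conjugate_diff: "conjugate (a - b :: 'a :: conjugatable_ring) = conjugate a - conjugate b"
  using conjugate_dist_add[of a "- b"] by (simp add: conjugate_neg)

lemma adj_mult:
  fixes A B :: "'a :: {comm_ring_1, conjugatable_ring} mat"
  assumes "A \<in> carrier_mat l m" "B \<in> carrier_mat m n"
  shows "adj (A * B) = adj B * adj A"
  using assms
  by (intro eq_matI)
    (auto simp: scalar_prod_def sum_conjugate conjugate_dist_mul mult.commute)

lemma adj_one [simp]: "adj (1\<^sub>m n :: 'a :: {comm_ring_1, conjugatable_ring} mat) = 1\<^sub>m n"
  by (rule eq_matI) auto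

lemma adj_zero [simp]: "adj (0\<^sub>m n m) = 0\<^sub>m m n"
  by (rule eq_matI) auto

lemma adj_minus:
  "A \<in> carrier_mat n m \<Longrightarrow> B \<in> carrier_mat n m \<Longrightarrow> adj (A - B) = adj A - adj B"
  by (rule eq_matI) (auto simp: conjugate_diff)

lemma adj_four_block:
  assumes "A \<in> carrier_mat a c" "B \<in> carrier_mat a d" "C \<in> carrier_mat b c" "D \<in> carrier_mat b d"
  shows "adj (four_block_mat A B C D) = four_block_mat (adj A) (adj C) (adj B) (adj D)"
  using assms by (intro eq_matI) auto

section \<open>Block-diagonal matrices\<close>

abbreviation bdiag :: "'a :: zero mat \<Rightarrow> 'a mat \<Rightarrow> 'a mat" where
  "bdiag A D \<equiv> four_block_mat A (0\<^sub>m (dim_row A) (dim_col D)) (0\<^sub>m (dim_row D) (dim_col A)) D"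

lemma bdiag_mult:
  fixes A D A' D' :: "'a :: {comm_ring_1, conjugatable_ring} mat"
  assumes "A \<in> carrier_mat r r" "D \<in> carrier_mat k k" "A' \<in> carrier_mat r r" "D' \<in> carrier_mat k k"
  shows "bdiag A D * bdiag A' D' = bdiag (A * A') (D * D')"
  using assms by (subst mult_four_block_mat[of _ r r _ k _ k _ _ r _ k]) auto

lemma bdiag_adj:
  fixes A D :: "'a :: {comm_ring_1, conjugatable_ring} mat"
  assumes "A \<in> carrier_mat r r" "D \<in> carrier_mat k k"
  shows "adj (bdiag A D) = bdiag (adj A) (adj D)"
  using assms by (subst adj_four_block[of _ r r _ k _ k]) auto

section \<open>Unitary matrices\<close>

definition unitary :: "nat \<Rightarrow> 'a :: {comm_ring_1, conjugatable_ring} mat \<Rightarrow> bool" where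
  "unitary n U \<longleftrightarrow> U \<in> carrier_mat n n \<and> adj U * U = 1\<^sub>m n \<and> U * adj U = 1\<^sub>m n"

lemma unitaryD:
  assumes "unitary n U"
  shows "U \<in> carrier_mat n n" "adj U \<in> carrier_mat n n" "adj U * U = 1\<^sub>m n" "U * adj U = 1\<^sub>m n"
  using assms by (auto simp: unitary_def)

lemma unitary_adj: "unitary n U \<Longrightarrow> unitary n (adj U)"
  by (auto simp: unitary_def)

lemma unitary_one: "unitary n (1\<^sub>m n)"
  by (auto simp: unitary_def)

lemma unitary_cancel:
  assumes "unitary n U" "A \<in> carrier_mat n m"
  shows "adj U * (U * A) = A" "U * (adj U * A) = A"
  using assms
  by (auto simp: unitary_def assoc_mult_mat[symmetric, of _ n n _ n _ m])

lemma unitary_cancel_right: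
  assumes "unitary n U" "A \<in> carrier_mat m n"
  shows "A * adj U * U = A" "A * U * adj U = A"
  using assms by (auto simp: unitary_def assoc_mult_mat[of _ m n _ n _ n])

lemma unitary_mult:
  assumes U: "unitary n U" and V: "unitary n V"
  shows "unitary n (U * V)"
proof -
  note c = unitaryD(1,2)[OF U] unitaryD(1,2)[OF V]
  have "adj (U * V) * (U * V) = adj V * (adj U * (U * V))"
    using c by (simp add: adj_mult[of _ n n _ n] assoc_mult_mat[of _ n n _ n _ n] mult_carrier_mat[of _ n n _ n])
  also have "\<dots> = 1\<^sub>m n" using c U V by (simp add: unitary_cancel[of n _ _ n] unitaryD(3,4)[of n])
  finally have 1: "adj (U * V) * (U * V) = 1\<^sub>m n" .
  have "U * V * adj (U * V) = U * (V * (adj V * adj U))"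
    using c by (simp add: adj_mult[of _ n n _ n] assoc_mult_mat[of _ n n _ n _ n] mult_carrier_mat[of _ n n _ n])
  also have "\<dots> = 1\<^sub>m n" using c U V by (simp add: unitary_cancel[of n _ _ n] unitaryD(3,4)[of n])
  finally show ?thesis using 1 c by (auto simp: unitary_def mult_carrier_mat[of _ n n _ n])
qed

lemma unitary_bdiag:
  assumes "unitary r U" "unitary k V"
  shows "unitary (r + k) (bdiag U V)"
proof -
  note c = unitaryD[OF assms(1)] unitaryD[OF assms(2)]
  show ?thesis unfolding unitary_def
    using c bdiag_mult[OF c(2,6,1,5)] bdiag_mult[OF c(1,5,2,6)] bdiag_adj[OF c(1,5)]
    by auto
qed

section \<open>Unitary equivalence\<close>

text \<open>With \<open>U = V\<close> this is unitary similarity, with a real nonnegative diagonal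
  \<open>B\<close> a singular value decomposition. The unitaries are arguments so that one pair can
  act on a standard and a dual part alike.\<close>

definition uequiv :: "nat \<Rightarrow> 'a :: {comm_ring_1, conjugatable_ring} mat \<Rightarrow> 'a mat \<Rightarrow> 'a mat \<Rightarrow> 'a mat \<Rightarrow> bool" where
  "uequiv n U V A B \<longleftrightarrow> unitary n U \<and> unitary n V \<and> B \<in> carrier_mat n n \<and> A = U * B * adj V"

lemma unitary_conj_back:
  assumes U: "unitary n U" and V: "unitary n V" and A: "A \<in> carrier_mat n n"
  shows "U * (adj U * A * V) * adj V = A"
proof -
  note c = unitaryD(1,2)[OF U] unitaryD(1,2)[OF V] A
  have "U * (adj U * A * V) * adj V = (U * (adj U * (A * V))) * adj V"
    using c by (simp add: assoc_mult_mat[of _ n n _ n _ n] mult_carrier_mat[of _ n n _ n])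
  also have "\<dots> = A * V * adj V" using c U by (simp add: unitary_cancel(2)[of n U _ n] mult_carrier_mat[of _ n n _ n])
  also have "\<dots> = A" using A V by (simp add: unitary_cancel_right)
  finally show ?thesis .
qed

lemma uequiv_conj:
  assumes U: "unitary n U" and V: "unitary n V" and A: "A \<in> carrier_mat n n"
  shows "uequiv n U V A (adj U * A * V)"
proof -
  note c = unitaryD(1,2)[OF U] unitaryD(1,2)[OF V] A
  have "adj U * A * V \<in> carrier_mat n n" using c by (auto simp: mult_carrier_mat[of _ n n _ n])
  then show ?thesis using unitary_conj_back[OF U V A] U V by (auto simp: uequiv_def)
qed

lemma uequiv_iff:
  assumes A: "A \<in> carrier_mat n n"
  shows "uequiv n U V A B \<longleftrightarrow> unitary n U \<and> unitary n V \<and> B = adj U * A * V"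
proof
  assume "unitary n U \<and> unitary n V \<and> B = adj U * A * V"
  then show "uequiv n U V A B" using uequiv_conj[OF _ _ A] by auto
next
  assume e: "uequiv n U V A B"
  then have U: "unitary n U" and V: "unitary n V" and B: "B \<in> carrier_mat n n" and AB: "A = U * B * adj V"
    by (auto simp: uequiv_def)
  have "B = adj U * A * V"
    using unitary_conj_back[OF unitary_adj[OF U] unitary_adj[OF V] B] AB by simp
  then show "unitary n U \<and> unitary n V \<and> B = adj U * A * V" using U V by simp
qed

lemma uequiv_trans:
  assumes "uequiv n U V A B" "uequiv n U' V' B C"
  shows "uequiv n (U * U') (V * V') A C"
proof -
  have UV: "unitary n U" "unitary n V" "A = U * B * adj V" using assms by (auto simp: uequiv_def)
  have UV': "unitary n U'" "unitary n V'" "B = U' * C * adj V'" using assms by (auto simp: uequiv_def)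
  have C: "C \<in> carrier_mat n n" using assms by (auto simp: uequiv_def)
  note c = unitaryD(1,2)[OF UV(1)] unitaryD(1,2)[OF UV(2)] unitaryD(1,2)[OF UV'(1)] unitaryD(1,2)[OF UV'(2)] C
  have "A = (U * U') * C * adj (V * V')"
    using c by (simp add: UV(3) UV'(3) adj_mult[of _ n n _ n] assoc_mult_mat[of _ n n _ n _ n] mult_carrier_mat[of _ n n _ n])
  then show ?thesis using C UV UV' by (auto simp: uequiv_def intro: unitary_mult)
qed

text \<open>Lets the inductions on the size and the dual decomposition treat diagonal blocks
  independently.\<close>

lemma uequiv_bdiag:
  assumes "uequiv r U V A A'" "uequiv k U' V' D D'"
  shows "uequiv (r + k) (bdiag U U') (bdiag V V') (bdiag A D) (bdiag A' D')"
proof -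
  have UV: "unitary r U" "unitary r V" "A = U * A' * adj V" "A' \<in> carrier_mat r r"
    using assms by (auto simp: uequiv_def)
  have UV': "unitary k U'" "unitary k V'" "D = U' * D' * adj V'" "D' \<in> carrier_mat k k"
    using assms by (auto simp: uequiv_def)
  note c = unitaryD(1,2)[OF UV(1)] unitaryD(1,2)[OF UV(2)] unitaryD(1,2)[OF UV'(1)] unitaryD(1,2)[OF UV'(2)] UV(4) UV'(4)
  have m: "U * A' \<in> carrier_mat r r" "U' * D' \<in> carrier_mat k k"
    using c by (auto simp: mult_carrier_mat[of _ r r _ r] mult_carrier_mat[of _ k k _ k])
  have "bdiag A D = bdiag (U * A') (U' * D') * bdiag (adj V) (adj V')"
    using bdiag_mult[OF m c(4,8)] UV UV' by simp
  also have "bdiag (U * A') (U' * D') = bdiag U U' * bdiag A' D'"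
    using bdiag_mult[of U r U' k A' D'] c by simp
  also have "bdiag (adj V) (adj V') = adj (bdiag V V')"
    using bdiag_adj[of V r V' k] c by simp
  finally show ?thesis
    using UV UV' by (auto simp: uequiv_def intro: unitary_bdiag)
qed

lemma uequiv_refl: "A \<in> carrier_mat n n \<Longrightarrow> uequiv n (1\<^sub>m n) (1\<^sub>m n) A A"
  by (auto simp: uequiv_def unitary_one)

section \<open>Diagonal matrices\<close>

definition dg :: "nat \<Rightarrow> (nat \<Rightarrow> 'a :: zero) \<Rightarrow> 'a mat" where
  "dg n f = mat n n (\<lambda>(i, j). if i = j then f i else 0)"

lemma dg_carrier [simp]: "dg n f \<in> carrier_mat n n" "dim_row (dg n f) = n" "dim_col (dg n f) = n"
  by (auto simp: dg_def)

lemma index_dg [simp]: "i < n \<Longrightarrow> j < n \<Longrightarrow> dg n f $$ (i, j) = (if i = j then f i else 0)"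
  by (auto simp: dg_def)

lemma dg_mult_left:
  fixes f :: "nat \<Rightarrow> 'a :: comm_ring_1"
  assumes "A \<in> carrier_mat n m" "i < n" "j < m"
  shows "(dg n f * A) $$ (i, j) = f i * A $$ (i, j)"
proof -
  have "(dg n f * A) $$ (i, j) = (\<Sum>k<n. (if i = k then f i else 0) * A $$ (k, j))"
    using assms by (auto simp: scalar_prod_def lessThan_atLeast0)
  also have "\<dots> = (\<Sum>k<n. if k = i then f i * A $$ (k, j) else 0)"
    by (intro sum.cong) auto
  also have "\<dots> = f i * A $$ (i, j)" using assms by simp
  finally show ?thesis .
qed

lemma dg_mult_right:
  fixes f :: "nat \<Rightarrow> 'a :: comm_ring_1"
  assumes "A \<in> carrier_mat n m" "i < n" "j < m"
  shows "(A * dg m f) $$ (i, j) = A $$ (i, j) * f j"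
proof -
  have "(A * dg m f) $$ (i, j) = (\<Sum>k<m. A $$ (i, k) * (if k = j then f k else 0))"
    using assms by (auto simp: scalar_prod_def lessThan_atLeast0)
  also have "\<dots> = (\<Sum>k<m. if k = j then A $$ (i, k) * f k else 0)"
    by (intro sum.cong) auto
  also have "\<dots> = A $$ (i, j) * f j" using assms by simp
  finally show ?thesis .
qed

lemma bdiag_dg: "bdiag (dg 1 (\<lambda>_. a)) (dg n f) = dg (Suc n) (case_nat a f)"
  by (rule eq_matI) (auto split: nat.split)

section \<open>Spectral theorem and singular values of complex matrices\<close>

lemma unitaryI_left:
  fixes U :: "complex mat"
  assumes "U \<in> carrier_mat n n" "adj U * U = 1\<^sub>m n"
  shows "unitary n U"
  using assms mat_mult_left_right_inverse[of "adj U" n U] by (auto simp: unitary_def)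

lemma unitary_completion:
  fixes u :: "complex vec"
  assumes u: "u \<in> carrier_vec n" and n: "n > 0" and norm: "(\<Sum>i<n. (cmod (u $ i))\<^sup>2) = 1"
  shows "\<exists>U. unitary n U \<and> col U 0 = u"
proof -
  \<comment> \<open>A Householder reflection exchanging \<open>u\<close> and \<open>c e\<^sub>0\<close>, times the phase \<open>c\<close>; the phase opposite to that of
    \<open>u\<^sub>0\<close> keeps \<open>w = u - c e\<^sub>0\<close> nonzero.\<close>
  define t where "t = cmod (u $ 0)"
  define c where "c = (if u $ 0 = 0 then 1 else - sgn (u $ 0))"
  define w where "w i = u $ i - (if i = 0 then c else 0)" for i
  \<comment> \<open>Anticipates the squared norm of \<open>w\<close>, computed below in
    \<open>W\<close>; thus \<open>h\<close> is the reflection along \<open>w\<close>.\<close>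
  define \<beta> where "\<beta> = complex_of_real (2 + 2 * t)"
  define h where "h i j = (if i = j then 1 else 0) - 2 * w i * cnj (w j) / \<beta>" for i j
  define U where "U = mat n n (\<lambda>(i, j). c * h i j)"
  have t: "t \<ge> 0" by (simp add: t_def)
  have cc: "cnj c * c = 1" "c * cnj c = 1"
    using complex_norm_square[of c] by (auto simp: c_def norm_sgn mult.commute)
  have u0: "u $ 0 = - c * t"
    by (auto simp: c_def t_def sgn_eq)
  have w0: "w 0 = - c * (t + 1)" by (simp add: w_def u0 algebra_simps)
  have cmodc: "cmod c = 1" by (auto simp: c_def norm_sgn)
  have "(\<Sum>k<n. (cmod (w k))\<^sup>2) = (cmod (w 0))\<^sup>2 + (\<Sum>k\<in>{..<n}-{0}. (cmod (w k))\<^sup>2)"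
    using n by (subst sum.remove[of _ 0]) auto
  also have "(\<Sum>k\<in>{..<n}-{0}. (cmod (w k))\<^sup>2) = (\<Sum>k\<in>{..<n}-{0}. (cmod (u $ k))\<^sup>2)"
    by (intro sum.cong) (auto simp: w_def)
  also have "\<dots> = 1 - t\<^sup>2"
    using n norm by (subst (asm) sum.remove[of _ 0]) (auto simp: t_def)
  also have "(cmod (w 0))\<^sup>2 = (t + 1)\<^sup>2"
  proof -
    have "cmod (of_real t + 1) = t + 1" using t by (metis norm_of_real of_real_1 of_real_add abs_of_nonneg add_nonneg_nonneg zero_le_one)
    then show ?thesis by (simp add: w0 norm_mult cmodc)
  qed
  finally have "(\<Sum>k<n. (cmod (w k))\<^sup>2) = 2 + 2 * t" by (simp add: power2_eq_square algebra_simps)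
  moreover have "(\<Sum>k<n. cnj (w k) * w k) = of_real (\<Sum>k<n. (cmod (w k))\<^sup>2)"
    by (simp add: mult.commute flip: complex_norm_square)
  ultimately have W: "(\<Sum>k<n. cnj (w k) * w k) = \<beta>"
    by (simp add: \<beta>_def)
  have \<beta>: "\<beta> \<noteq> 0" using t unfolding \<beta>_def by (simp only: of_real_eq_0_iff)
  have \<beta>c: "cnj \<beta> = \<beta>" by (simp add: \<beta>_def)
  have "adj U * U = 1\<^sub>m n"
  proof (rule eq_matI)
    fix i j assume "i < dim_row (1\<^sub>m n :: complex mat)" "j < dim_col (1\<^sub>m n :: complex mat)"
    then have ij: "i < n" "j < n" by auto
    have "(adj U * U) $$ (i, j) = (\<Sum>k<n. cnj (c * h k i) * (c * h k j))"
      using ij by (simp add: U_def scalar_prod_def lessThan_atLeast0)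
    also have "\<dots> = (\<Sum>k<n. cnj (h k i) * h k j)"
    proof (rule sum.cong[OF refl])
      fix k
      have "cnj (c * h k i) * (c * h k j) = (cnj c * c) * (cnj (h k i) * h k j)" by (simp add: ac_simps)
      then show "cnj (c * h k i) * (c * h k j) = cnj (h k i) * h k j" by (simp add: cc)
    qed
    \<comment> \<open>The product is sorted by its Kronecker deltas; the last summand collects the
      squared norm of \<open>w\<close>.\<close>
    also have "\<dots> = (\<Sum>k<n. (if k = i then (if k = j then 1 else 0) - 2 * w k * cnj (w j) / \<beta> else 0)
        + (if k = j then - 2 * cnj (w k) * w i / \<beta> else 0)
        + (4 * w i * cnj (w j) / \<beta>\<^sup>2) * (cnj (w k) * w k))"
      by (intro sum.cong refl) (auto simp: h_def \<beta>c power2_eq_square field_simps \<beta>)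
    also have "\<dots> = ((if i = j then 1 else 0) - 2 * w i * cnj (w j) / \<beta>) - 2 * cnj (w j) * w i / \<beta>
        + (4 * w i * cnj (w j) / \<beta>\<^sup>2) * \<beta>"
      using ij by (simp add: sum.distrib W flip: sum_distrib_left sum_divide_distrib)
    also have "\<dots> = (if i = j then 1 else 0)"
      using \<beta> by (simp add: power2_eq_square)
    finally show "(adj U * U) $$ (i, j) = 1\<^sub>m n $$ (i, j)" using ij by simp
  qed (auto simp: U_def)
  then have 1: "unitary n U" by (intro unitaryI_left) (auto simp: U_def)
  have "col U 0 = u"
  proof (rule eq_vecI)
    fix i assume "i < dim_vec u"
    then have i: "i < n" using u by auto
    have b: "\<beta> = 2 * (of_real t + 1)" by (simp add: \<beta>_def)
    have "col U 0 $ i = c * h i 0" using i n by (simp add: U_def)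
    \<comment> \<open>By \<open>w0\<close>, the factor \<open>cnj (w 0)\<close> is
      \<open>- cnj c\<close> times half of \<open>\<beta>\<close>.\<close>
    also have "\<dots> = c * (if i = 0 then 1 else 0) + c * cnj c * w i * (2 * (of_real t + 1) / \<beta>)"
      by (simp add: h_def w0 algebra_simps diff_divide_distrib add_divide_distrib)
    also have "2 * (of_real t + 1) / \<beta> = 1" using \<beta> by (simp only: flip: b) simp
    finally have "col U 0 $ i = c * (if i = 0 then 1 else 0) + w i" by (simp add: cc)
    then have "col U 0 $ i = u $ i" by (simp add: w_def)
    then show "col U 0 $ i = u $ i" .
  qed (use u in \<open>auto simp: U_def\<close>)
  with 1 show ?thesis by auto
qed

text \<open>The deflation step of both inductions below: two unit vectors matched by
  \<open>A\<close>, taken as first columns, clear the first column of the transformed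
  matrix.\<close>

lemma unitary_conj_col_zero:
  fixes A :: "complex mat"
  assumes U: "unitary n U" and V: "unitary n V" and A: "A \<in> carrier_mat n n" and i: "i < n"
    and Av: "A *\<^sub>v col V 0 = c \<cdot>\<^sub>v col U 0"
  shows "(adj U * A * V) $$ (i, 0) = (if i = 0 then c else 0)"
proof -
  note c = unitaryD[OF U] unitaryD[OF V] A
  have c1: "adj U * A \<in> carrier_mat n n" using c by (auto intro: mult_carrier_mat)
  have n: "0 < n" using i by simp
  have cU: "col U 0 \<in> carrier_vec n" "col V 0 \<in> carrier_vec n" using c n by auto
  have "(adj U * A * V) $$ (i, 0) = col (adj U * A * V) 0 $ i" using i c by simp
  also have "col (adj U * A * V) 0 = (adj U * A) *\<^sub>v col V 0" by (rule col_mult2[OF c1 c(5) n])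
  also have "\<dots> = adj U *\<^sub>v (A *\<^sub>v col V 0)" by (rule assoc_mult_mat_vec[OF c(2,9) cU(2)])
  also have "\<dots> = c \<cdot>\<^sub>v (adj U *\<^sub>v col U 0)"
    unfolding Av by (rule mult_mat_vec[OF c(2) cU(1)])
  also have "adj U *\<^sub>v col U 0 = col (adj U * U) 0"
    using col_mult2[OF c(2,1) n] by simp
  also have "\<dots> = unit_vec n 0" using c n by simp
  also have "(c \<cdot>\<^sub>v unit_vec n 0) $ i = (if i = 0 then c else 0)" using i by simp
  finally show ?thesis .
qed

lemma bdiag_split:
  fixes M :: "'a :: comm_ring_1 mat"
  assumes M: "M \<in> carrier_mat (Suc n) (Suc n)"
    and z: "\<And>i. 0 < i \<Longrightarrow> i < Suc n \<Longrightarrow> M $$ (i, 0) = 0 \<and> M $$ (0, i) = 0"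
  shows "\<exists>M2 \<in> carrier_mat n n. M = bdiag (dg 1 (\<lambda>_. M $$ (0, 0))) M2"
  using M z by (intro bexI[of _ "mat n n (\<lambda>(i, j). M $$ (Suc i, Suc j))"] eq_matI) auto

lemma bdiag_inject:
  assumes "bdiag A D = bdiag A' D'" "A \<in> carrier_mat r r" "A' \<in> carrier_mat r r"
    "D \<in> carrier_mat k k" "D' \<in> carrier_mat k k"
  shows "D = D'"
proof (rule eq_matI)
  fix i j assume "i < dim_row D'" "j < dim_col D'"
  then show "D $$ (i, j) = D' $$ (i, j)"
    using assms(2-) arg_cong[OF assms(1), of "\<lambda>M. M $$ (r + i, r + j)"] by auto
qed (use assms in auto)

text \<open>Turns matrix identities into identities between sums of squares, from which entries are
  seen to vanish.\<close>

lemma index_mult_adj_same: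
  fixes M :: "complex mat"
  assumes "M \<in> carrier_mat n m" "i < n"
  shows "(M * adj M) $$ (i, i) = of_real (\<Sum>k<m. (cmod (M $$ (i, k)))\<^sup>2)"
  using assms by (simp add: scalar_prod_def lessThan_atLeast0 flip: complex_norm_square)

section \<open>Diagonalisation of normal matrices\<close>

text \<open>The complex spectrum of a matrix of positive size is nonempty; the eigenvector found is
  divided by its norm.\<close>

lemma unit_eigenvector:
  fixes T :: "complex mat"
  assumes T: "T \<in> carrier_mat n n" and n: "0 < n"
  shows "\<exists>l v. v \<in> carrier_vec n \<and> (\<Sum>i<n. (cmod (v $ i))\<^sup>2) = 1 \<and> T *\<^sub>v v = l \<cdot>\<^sub>v v"
proof -
  obtain l where "l \<in> spectrum T" using spectrum_non_empty[OF T n] by auto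
  then obtain v where v: "v \<in> carrier_vec n" "v \<noteq> 0\<^sub>v n" "T *\<^sub>v v = l \<cdot>\<^sub>v v"
    using T by (auto simp: spectrum_def eigenvalue_def eigenvector_def)
  define s where "s = (\<Sum>i<n. (cmod (v $ i))\<^sup>2)"
  have "s \<noteq> 0"
  proof
    assume "s = 0"
    then have "\<forall>i<n. v $ i = 0" by (simp add: s_def sum_nonneg_eq_0_iff)
    then have "v = 0\<^sub>v n" using v by (intro eq_vecI) auto
    with v show False by simp
  qed
  moreover have "s \<ge> 0" by (simp add: s_def sum_nonneg)
  ultimately have s: "s > 0" by simp
  define w where "w = complex_of_real (1 / sqrt s) \<cdot>\<^sub>v v"
  have "(\<Sum>i<n. (cmod (w $ i))\<^sup>2) = (\<Sum>i<n. (cmod (v $ i))\<^sup>2 / s)"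
    using s v by (intro sum.cong) (auto simp: w_def norm_mult norm_divide power_divide)
  also have "\<dots> = 1" using s by (simp add: s_def flip: sum_divide_distrib)
  finally have "(\<Sum>i<n. (cmod (w $ i))\<^sup>2) = 1" .
  moreover have "T *\<^sub>v w = l \<cdot>\<^sub>v w"
    unfolding w_def using v by (simp add: mult_mat_vec[OF T v(1)] smult_smult_assoc mult.commute)
  ultimately show ?thesis using v by (auto simp: w_def intro!: exI[of _ l] exI[of _ w])
qed

text \<open>Induction on the size. A unit eigenvector, completed to a unitary matrix, clears the
  first column below the diagonal; normality then clears the rest of the first row, and the
  remaining block is again normal.\<close>

theorem normal_spectral:
  fixes T :: "complex mat"
  assumes "T \<in> carrier_mat n n" "T * adj T = adj T * T"
  shows "\<exists>W f. uequiv n W W T (dg n f)"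
  using assms
proof (induction n arbitrary: T)
  case 0
  then have "T = dg 0 (\<lambda>_. 0)" by (intro eq_matI) auto
  then show ?case using uequiv_refl[of T 0] 0 by metis
next
  case (Suc n)
  let ?n = "Suc n"
  note T = Suc.prems(1)
  obtain l v where v: "v \<in> carrier_vec ?n" "(\<Sum>i<?n. (cmod (v $ i))\<^sup>2) = 1" "T *\<^sub>v v = l \<cdot>\<^sub>v v"
    using unit_eigenvector[OF T] by auto
  obtain U where U: "unitary ?n U" "col U 0 = v" using unitary_completion[OF v(1) _ v(2)] by auto
  define M where "M = adj U * T * U"
  note c = unitaryD(1,2)[OF U(1)] T adj_carrier[OF T]
  have M: "M \<in> carrier_mat ?n ?n" using c by (auto simp: M_def mult_carrier_mat[of _ ?n ?n _ ?n])
  have adjM: "adj M = adj U * adj T * U"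
    using c by (simp add: M_def adj_mult[of _ ?n ?n _ ?n] assoc_mult_mat[of _ ?n ?n _ ?n _ ?n] mult_carrier_mat[of _ ?n ?n _ ?n])
  \<comment> \<open>Conjugation by \<open>U\<close> is multiplicative, so \<open>M\<close> inherits
    normality from \<open>T\<close>.\<close>
  have conj_mult: "(adj U * X * U) * (adj U * Y * U) = adj U * (X * Y) * U"
    if X: "X \<in> carrier_mat ?n ?n" and Y: "Y \<in> carrier_mat ?n ?n" for X Y
  proof -
    have "(adj U * X * U) * (adj U * Y * U) = adj U * (X * (U * (adj U * (Y * U))))"
      using c X Y by (simp add: assoc_mult_mat[of _ ?n ?n _ ?n _ ?n] mult_carrier_mat[of _ ?n ?n _ ?n])
    also have "U * (adj U * (Y * U)) = Y * U"
      using c Y by (intro unitary_cancel(2)[OF U(1), of _ ?n]) (auto simp: mult_carrier_mat[of _ ?n ?n _ ?n])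
    finally show ?thesis
      using c X Y by (simp add: assoc_mult_mat[of _ ?n ?n _ ?n _ ?n] mult_carrier_mat[of _ ?n ?n _ ?n])
  qed
  have nM: "M * adj M = adj M * M"
    unfolding adjM unfolding M_def using conj_mult[OF c(3,4)] conj_mult[OF c(4,3)] Suc.prems(2) by simp
  have c0: "M $$ (i, 0) = (if i = 0 then l else 0)" if "i < ?n" for i
    unfolding M_def using unitary_conj_col_zero[OF U(1) U(1) T that] v U by simp
  \<comment> \<open>Normality equates the norm of row 0 with that of column 0, whose only nonzero
    entry can be \<open>l\<close>.\<close>
  have "(\<Sum>k<?n. (cmod (M $$ (0, k)))\<^sup>2) = (cmod l)\<^sup>2"
  proof -
    have "complex_of_real (\<Sum>k<?n. (cmod (M $$ (0, k)))\<^sup>2) = (adj M * adj (adj M)) $$ (0, 0)"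
      using index_mult_adj_same[OF M, of 0] nM by simp
    also have "\<dots> = of_real (\<Sum>k<?n. (cmod (adj M $$ (0, k)))\<^sup>2)"
      using M by (intro index_mult_adj_same[of _ ?n]) auto
    also have "(\<Sum>k<?n. (cmod (adj M $$ (0, k)))\<^sup>2) = (\<Sum>k<?n. if k = 0 then (cmod l)\<^sup>2 else 0)"
      using M by (intro sum.cong) (auto simp: c0)
    also have "\<dots> = (cmod l)\<^sup>2" by simp
    finally show ?thesis by (simp only: of_real_eq_iff)
  qed
  moreover have "(\<Sum>k<?n. (cmod (M $$ (0, k)))\<^sup>2) = (cmod (M $$ (0, 0)))\<^sup>2 + (\<Sum>k\<in>{..<?n} - {0}. (cmod (M $$ (0, k)))\<^sup>2)"
    by (subst sum.remove[of _ 0]) auto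
  ultimately have "(\<Sum>k\<in>{..<?n} - {0}. (cmod (M $$ (0, k)))\<^sup>2) = 0" by (simp add: c0)
  then have r0: "M $$ (0, k) = 0" if "0 < k" "k < ?n" for k
    using that by (subst (asm) sum_nonneg_eq_0_iff) auto
  obtain M2 where M2: "M2 \<in> carrier_mat n n" "M = bdiag (dg 1 (\<lambda>_. l)) M2"
    using bdiag_split[OF M] r0 c0 by auto
  let ?L = "dg 1 (\<lambda>_. l) :: complex mat"
  have a: "adj M = bdiag (adj ?L) (adj M2)" using bdiag_adj[of ?L 1 M2 n] M2 by simp
  \<comment> \<open>The lower blocks of the normality equation for \<open>M\<close> give the one for
    \<open>M2\<close>.\<close>
  have "bdiag (?L * adj ?L) (M2 * adj M2) = bdiag (adj ?L * ?L) (adj M2 * M2)"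
    using nM a bdiag_mult[of ?L 1 M2 n "adj ?L" "adj M2"] bdiag_mult[of "adj ?L" 1 "adj M2" n ?L M2] M2 by simp
  then have "M2 * adj M2 = adj M2 * M2"
    using M2 by (elim bdiag_inject[of _ _ _ _ 1 n]) (auto simp: mult_carrier_mat[of _ n n _ n] mult_carrier_mat[of _ 1 1 _ 1])
  then obtain W f where W: "uequiv n W W M2 (dg n f)" using Suc.IH[OF M2(1)] by auto
  have "uequiv (1 + n) (bdiag (1\<^sub>m 1) W) (bdiag (1\<^sub>m 1) W) M (bdiag ?L (dg n f))"
    unfolding M2(2) by (intro uequiv_bdiag[OF _ W] uequiv_refl) auto
  then have "uequiv ?n (bdiag (1\<^sub>m 1) W) (bdiag (1\<^sub>m 1) W) M (dg ?n (case_nat l f))"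
    by (simp only: bdiag_dg plus_1_eq_Suc)
  moreover have "uequiv ?n U U T M" unfolding M_def by (rule uequiv_conj[OF U(1) U(1) T])
  ultimately show ?case using uequiv_trans by blast
qed

section \<open>Singular values of a complex matrix\<close>

lemma sum_cmod_unitary_col:
  assumes U: "unitary n U" and i: "i < n"
  shows "(\<Sum>k<n. (cmod (U $$ (k, i)))\<^sup>2) = 1"
proof -
  note c = unitaryD[OF U]
  have "complex_of_real (\<Sum>k<n. (cmod (adj U $$ (i, k)))\<^sup>2) = (adj U * adj (adj U)) $$ (i, i)"
    by (rule index_mult_adj_same[OF c(2) i, symmetric])
  also have "\<dots> = 1" using c i by simp
  finally have "(\<Sum>k<n. (cmod (adj U $$ (i, k)))\<^sup>2) = 1" by (simp only: of_real_eq_1_iff)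
  then show ?thesis using c i by simp
qed

text \<open>Induction on the size. If \<open>A\<close> is not zero, then \<open>adj A * A\<close>
  has a positive eigenvalue, the square of some \<open>\<sigma> > 0\<close>, with a unit eigenvector
  \<open>v\<close>. For the unit vector \<open>u = A v / \<sigma>\<close> also \<open>adj A\<close>
  maps \<open>u\<close> to \<open>\<sigma> v\<close>, so unitary matrices with first columns
  \<open>u\<close> and \<open>v\<close> split off the entry \<open>\<sigma>\<close>. The recursion
  ends at a zero matrix, which puts the zero values last.\<close>

theorem complex_svd:
  fixes A :: "complex mat"
  assumes "A \<in> carrier_mat n n"
  shows "\<exists>U V r s. uequiv n U V A (dg n (\<lambda>i. complex_of_real (s i))) \<and> r \<le> n \<and>
    (\<forall>i<r. s i > 0) \<and> (\<forall>i\<ge>r. s i = 0)"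
  using assms
proof (induction n arbitrary: A)
  case 0
  then have "A = dg 0 (\<lambda>i. complex_of_real ((\<lambda>_. 0) i))" by (intro eq_matI) auto
  then show ?case using uequiv_refl[of A 0] 0 by (intro exI[of _ "1\<^sub>m 0"] exI[of _ 0] exI[of _ "\<lambda>_. 0"]) auto
next
  case (Suc n)
  let ?n = "Suc n"
  note A = Suc.prems
  show ?case
  proof (cases "A = 0\<^sub>m ?n ?n")
    case True
    then have "A = dg ?n (\<lambda>i. complex_of_real ((\<lambda>_. 0) i))" by (intro eq_matI) auto
    then show ?thesis using uequiv_refl[OF A] by (intro exI[of _ "1\<^sub>m ?n"] exI[of _ 0] exI[of _ "\<lambda>_. 0"]) auto
  next
    case False
    define H where "H = adj A * A"
    have aA: "adj A \<in> carrier_mat ?n ?n" using A by simp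
    have H: "H \<in> carrier_mat ?n ?n" using A aA by (auto simp: H_def intro: mult_carrier_mat)
    have "adj H = H" using adj_mult[OF aA A] by (simp add: H_def)
    then obtain W f where e: "uequiv ?n W W H (dg ?n f)" using normal_spectral[OF H] by auto
    then have W: "unitary ?n W" and Hf: "H = W * dg ?n f * adj W"
      by (auto simp: uequiv_def)
    have f: "dg ?n f = adj W * H * W"
      using e uequiv_iff[OF H] by blast
    note c = unitaryD[OF W] A aA H
    have AW: "A * W \<in> carrier_mat ?n ?n" using c by (auto intro: mult_carrier_mat)
    have fAW: "dg ?n f = adj (A * W) * adj (adj (A * W))"
      using c by (simp add: f H_def adj_mult[of _ ?n ?n _ ?n] assoc_mult_mat[of _ ?n ?n _ ?n _ ?n] mult_carrier_mat[of _ ?n ?n _ ?n])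
    \<comment> \<open>The eigenvalues of \<open>H\<close> are the squared column norms of
      \<open>A * W\<close>, hence real and nonnegative.\<close>
    have fi: "f i = of_real (\<Sum>k<?n. (cmod ((A * W) $$ (k, i)))\<^sup>2)" if "i < ?n" for i
    proof -
      have "f i = of_real (\<Sum>k<?n. (cmod (adj (A * W) $$ (i, k)))\<^sup>2)"
        using index_mult_adj_same[OF adj_carrier[OF AW] that] index_dg[OF that that, of f]
        by (simp del: sum.lessThan_Suc adj_adj add: fAW)
      also have "(\<Sum>k<?n. (cmod (adj (A * W) $$ (i, k)))\<^sup>2) = (\<Sum>k<?n. (cmod ((A * W) $$ (k, i)))\<^sup>2)"
        using that c by (intro sum.cong refl) auto
      finally show ?thesis .
    qed
    \<comment> \<open>If all eigenvalues vanished, so would \<open>H\<close>, whose diagonal holds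
      the squared column norms of \<open>A\<close>; then \<open>A\<close> would be zero.\<close>
    obtain i where i: "i < ?n" "f i \<noteq> 0"
    proof (rule ccontr)
      assume "\<not> thesis"
      with that have "\<forall>i<?n. f i = 0" by auto
      then have "dg ?n f = 0\<^sub>m ?n ?n" by (intro eq_matI) auto
      then have H0: "H = 0\<^sub>m ?n ?n" using Hf c by simp
      have "A $$ (k, j) = 0" if "k < ?n" "j < ?n" for k j
      proof -
        have "complex_of_real (\<Sum>k<?n. (cmod (adj A $$ (j, k)))\<^sup>2) = H $$ (j, j)"
          using index_mult_adj_same[OF aA that(2)] by (simp add: H_def)
        also have "\<dots> = 0" using H0 that by simp
        finally have "(\<Sum>k<?n. (cmod (adj A $$ (j, k)))\<^sup>2) = 0" by (simp only: of_real_eq_0_iff)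
        then show ?thesis using that A by (subst (asm) sum_nonneg_eq_0_iff) auto
      qed
      with False show False using A by (auto intro!: eq_matI)
    qed
    define p where "p = (\<Sum>k<?n. (cmod ((A * W) $$ (k, i)))\<^sup>2)"
    have fp: "f i = of_real p" using fi[OF i(1)] by (simp add: p_def)
    have "p \<ge> 0" by (simp add: p_def sum_nonneg)
    with fp i have p: "p > 0" by (cases "p = 0") auto
    define \<sigma> where "\<sigma> = sqrt p"
    have \<sigma>: "\<sigma> > 0" "\<sigma> * \<sigma> = p" using p by (auto simp: \<sigma>_def)
    have \<sigma>': "complex_of_real \<sigma> \<noteq> 0" "of_real p = complex_of_real \<sigma> * of_real \<sigma>"
      using \<sigma> by auto
    define v where "v = col W i"
    define u where "u = complex_of_real (1 / \<sigma>) \<cdot>\<^sub>v (A *\<^sub>v v)"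
    have v: "v \<in> carrier_vec ?n" using c i by (auto simp: v_def)
    have vn: "(\<Sum>k<?n. (cmod (v $ k))\<^sup>2) = 1"
      using sum_cmod_unitary_col[OF W i(1)] c i by (simp add: v_def del: sum.lessThan_Suc)
    have Av: "A *\<^sub>v v = col (A * W) i" "A *\<^sub>v v \<in> carrier_vec ?n"
      using col_mult2[OF A c(1) i(1)] mult_mat_vec_carrier[OF A v] by (auto simp: v_def)
    have u: "u \<in> carrier_vec ?n" using Av by (auto simp: u_def)
    have un: "(\<Sum>k<?n. (cmod (u $ k))\<^sup>2) = 1"
    proof -
      have "(\<Sum>k<?n. (cmod (u $ k))\<^sup>2) = (\<Sum>k<?n. (cmod ((A * W) $$ (k, i)))\<^sup>2 / p)"
        using Av(2) A c(1) i \<sigma>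
        by (intro sum.cong refl) (auto simp: u_def Av(1) norm_mult norm_divide power_divide power2_eq_square)
      also have "\<dots> = 1" using p by (simp add: p_def flip: sum_divide_distrib del: sum.lessThan_Suc)
      finally show ?thesis .
    qed
    have Avu: "A *\<^sub>v v = of_real \<sigma> \<cdot>\<^sub>v u"
      using \<sigma>' by (simp add: u_def smult_smult_assoc)
    have "H * W = W * dg ?n f"
      using c by (simp add: Hf unitary_cancel_right[OF W, of _ ?n] mult_carrier_mat[of _ ?n ?n _ ?n])
    then have "H *\<^sub>v v = col (W * dg ?n f) i"
      using col_mult2[OF H c(1) i(1)] by (simp add: v_def)
    also have "\<dots> = of_real p \<cdot>\<^sub>v v"
      using c i by (intro eq_vecI) (auto simp: v_def dg_mult_right[of _ ?n ?n] fp simp del: index_mult_mat(1))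
    finally have Hv: "H *\<^sub>v v = of_real p \<cdot>\<^sub>v v" .
    have aAu: "adj A *\<^sub>v u = of_real \<sigma> \<cdot>\<^sub>v v"
    proof -
      have "adj A *\<^sub>v u = of_real (1 / \<sigma>) \<cdot>\<^sub>v (adj A *\<^sub>v (A *\<^sub>v v))"
        unfolding u_def by (rule mult_mat_vec[OF aA Av(2)])
      also have "adj A *\<^sub>v (A *\<^sub>v v) = H *\<^sub>v v"
        unfolding H_def by (rule assoc_mult_mat_vec[OF aA A v, symmetric])
      also have "of_real (1 / \<sigma>) \<cdot>\<^sub>v \<dots> = of_real \<sigma> \<cdot>\<^sub>v v"
        using \<sigma>' by (simp add: Hv smult_smult_assoc)
      finally show ?thesis .
    qed
    obtain U where U: "unitary ?n U" "col U 0 = u" using unitary_completion[OF u _ un] by auto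
    obtain V where V: "unitary ?n V" "col V 0 = v" using unitary_completion[OF v _ vn] by auto
    note d = unitaryD(1,2)[OF U(1)] unitaryD(1,2)[OF V(1)]
    define M where "M = adj U * A * V"
    have M: "M \<in> carrier_mat ?n ?n" using c d by (auto simp: M_def mult_carrier_mat[of _ ?n ?n _ ?n])
    have c0: "M $$ (k, 0) = (if k = 0 then of_real \<sigma> else 0)" if "k < ?n" for k
      unfolding M_def using unitary_conj_col_zero[OF U(1) V(1) A that] Avu U V by simp
    have aM: "adj M = adj V * adj A * U"
      using c d by (simp add: M_def adj_mult[of _ ?n ?n _ ?n] assoc_mult_mat[of _ ?n ?n _ ?n _ ?n] mult_carrier_mat[of _ ?n ?n _ ?n])
    \<comment> \<open>Deflation applied to \<open>adj A\<close>, by \<open>aAu\<close>, clears the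
      first row of \<open>M\<close>.\<close>
    have "adj M $$ (k, 0) = (if k = 0 then of_real \<sigma> else 0)" if "k < ?n" for k
      unfolding aM using unitary_conj_col_zero[OF V(1) U(1) aA that] aAu U V by simp
    then have r0: "M $$ (0, k) = 0" if "0 < k" "k < ?n" for k
      using M that by fastforce
    obtain M2 where M2: "M2 \<in> carrier_mat n n" "M = bdiag (dg 1 (\<lambda>_. of_real \<sigma>)) M2"
      using bdiag_split[OF M] r0 c0 by auto
    obtain U' V' r s where IH: "uequiv n U' V' M2 (dg n (\<lambda>i. complex_of_real (s i)))" "r \<le> n"
      "\<forall>i<r. s i > 0" "\<forall>i\<ge>r. s i = 0" using Suc.IH[OF M2(1)] by auto
    have "uequiv (1 + n) (bdiag (1\<^sub>m 1) U') (bdiag (1\<^sub>m 1) V') M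
        (bdiag (dg 1 (\<lambda>_. of_real \<sigma>)) (dg n (\<lambda>i. complex_of_real (s i))))"
      unfolding M2(2) by (intro uequiv_bdiag[OF _ IH(1)] uequiv_refl) auto
    moreover have "case_nat (of_real \<sigma>) (\<lambda>i. complex_of_real (s i)) = (\<lambda>i. of_real (case_nat \<sigma> s i))"
      by (rule ext) (auto split: nat.split)
    ultimately have "uequiv ?n (bdiag (1\<^sub>m 1) U') (bdiag (1\<^sub>m 1) V') M (dg ?n (\<lambda>i. of_real (case_nat \<sigma> s i)))"
      by (simp only: bdiag_dg plus_1_eq_Suc)
    moreover have "uequiv ?n U V A M" unfolding M_def by (rule uequiv_conj[OF U(1) V(1) A])
    ultimately obtain U2 V2 where "uequiv ?n U2 V2 A (dg ?n (\<lambda>i. of_real (case_nat \<sigma> s i)))"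
      using uequiv_trans by blast
    moreover have "\<forall>i<Suc r. case_nat \<sigma> s i > 0" "\<forall>i\<ge>Suc r. case_nat \<sigma> s i = 0"
      using IH \<sigma> by (auto split: nat.split)
    ultimately show ?thesis using IH(2) by (intro exI[of _ U2] exI[of _ V2] exI[of _ "Suc r"] exI[of _ "case_nat \<sigma> s"]) simp
  qed
qed

section \<open>Singular value decomposition of dual complex matrices\<close>

lemma dcomplex_simps [simp]:
  "std_part 0 = 0" "dual_part 0 = 0" "std_part 1 = 1" "dual_part 1 = 0"
  "std_part (x + y) = std_part x + std_part y" "dual_part (x + y) = dual_part x + dual_part y"
  "std_part (x - y) = std_part x - std_part y" "dual_part (x - y) = dual_part x - dual_part y"
  "std_part (- x) = - std_part x" "dual_part (- x) = - dual_part x"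
  "std_part (x * y) = std_part x * std_part y"
  "dual_part (x * y) = std_part x * dual_part y + dual_part x * std_part y"
  "std_part (conjugate x) = cnj (std_part x)" "dual_part (conjugate x) = cnj (dual_part x)"
  by (auto simp: zero_dcomplex_def one_dcomplex_def plus_dcomplex_def minus_dcomplex_def
      uminus_dcomplex_def times_dcomplex_def conjugate_dcomplex_def)

lemma std_part_sum [simp]: "std_part (\<Sum>i\<in>I. f i) = (\<Sum>i\<in>I. std_part (f i))"
  by (induction I rule: infinite_finite_induct) auto

lemma dual_part_sum [simp]: "dual_part (\<Sum>i\<in>I. f i) = (\<Sum>i\<in>I. dual_part (f i))"
  by (induction I rule: infinite_finite_induct) auto

section \<open>Dual matrices as pairs of complex matrices\<close>

definition dmat :: "complex mat \<Rightarrow> complex mat \<Rightarrow> dcmat" where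
  "dmat S G = mat (dim_row S) (dim_col S) (\<lambda>(i, j). DC (S $$ (i, j)) (G $$ (i, j)))"

lemma dmat_carrier [simp]: "S \<in> carrier_mat n m \<Longrightarrow> dmat S G \<in> carrier_mat n m"
  by (auto simp: dmat_def)

lemma dim_dmat [simp]: "dim_row (dmat S G) = dim_row S" "dim_col (dmat S G) = dim_col S"
  by (auto simp: dmat_def)

lemma index_dmat [simp]: "i < dim_row S \<Longrightarrow> j < dim_col S \<Longrightarrow> dmat S G $$ (i, j) = DC (S $$ (i, j)) (G $$ (i, j))"
  by (auto simp: dmat_def)

lemma dmat_parts: "A = dmat (map_mat std_part A) (map_mat dual_part A)"
  by (rule eq_matI) auto

lemma dmat_mult:
  assumes "S \<in> carrier_mat n m" "G \<in> carrier_mat n m" "S' \<in> carrier_mat m k" "G' \<in> carrier_mat m k"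
  shows "dmat S G * dmat S' G' = dmat (S * S') (S * G' + G * S')"
  using assms
  by (intro eq_matI) (auto simp: scalar_prod_def sum.distrib intro!: dcomplex.expand)

lemma adj_dmat:
  assumes "S \<in> carrier_mat n m" "G \<in> carrier_mat n m"
  shows "adj (dmat S G) = dmat (adj S) (adj G)"
  using assms by (intro eq_matI) (auto intro: dcomplex.expand)

lemma one_dmat: "1\<^sub>m n = dmat (1\<^sub>m n) (0\<^sub>m n n)"
  by (rule eq_matI) (auto intro: dcomplex.expand)

lemma unitary_dmat:
  assumes "unitary n U"
  shows "unitary n (dmat U (0\<^sub>m n n))"
proof -
  note c = unitaryD[OF assms]
  show ?thesis unfolding unitary_def
    using c adj_dmat[of U n n "0\<^sub>m n n"] dmat_mult[of U n n "0\<^sub>m n n" "adj U" n "0\<^sub>m n n"]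
      dmat_mult[of "adj U" n n "0\<^sub>m n n" U n "0\<^sub>m n n"] one_dmat[of n] by simp
qed

text \<open>For skew-Hermitian \<open>K\<close> the adjoint of \<open>I + K \<epsilon>\<close> is
  \<open>I - K \<epsilon>\<close>, which is its inverse because \<open>\<epsilon>\<close> squares to
  zero.\<close>

lemma unitary_one_plus_skew:
  assumes K: "K \<in> carrier_mat n n" and skew: "adj K = - K"
  shows "unitary n (dmat (1\<^sub>m n) K)"
proof -
  have "dmat (1\<^sub>m n) (- K) * dmat (1\<^sub>m n) K = 1\<^sub>m n" "dmat (1\<^sub>m n) K * dmat (1\<^sub>m n) (- K) = 1\<^sub>m n"
    using K dmat_mult[of "1\<^sub>m n" n n "- K" "1\<^sub>m n" n K] dmat_mult[of "1\<^sub>m n" n n K "1\<^sub>m n" n "- K"]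
    by (auto simp: one_dmat[of n] intro!: eq_matI)
  then show ?thesis unfolding unitary_def
    using K adj_dmat[of "1\<^sub>m n" n n K] skew by simp
qed

text \<open>Unitary matrices with zero dual part act on both parts separately, so a reduction of the
  standard part carries the dual part along.\<close>

lemma uequiv_dmat:
  assumes e: "uequiv n U V S T" and S: "S \<in> carrier_mat n n" and G: "G \<in> carrier_mat n n"
  shows "uequiv n (dmat U (0\<^sub>m n n)) (dmat V (0\<^sub>m n n)) (dmat S G) (dmat T (adj U * G * V))"
proof -
  have U: "unitary n U" and V: "unitary n V" and T: "T = adj U * S * V"
    using e uequiv_iff[OF S] by blast+
  note c = unitaryD(1,2)[OF U] unitaryD(1,2)[OF V] S G
  have c': "adj U * S \<in> carrier_mat n n" "adj U * G \<in> carrier_mat n n"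
    using c by (auto intro: mult_carrier_mat)
  have "adj (dmat U (0\<^sub>m n n)) * dmat S G * dmat V (0\<^sub>m n n) = dmat (adj U * S) (adj U * G) * dmat V (0\<^sub>m n n)"
    using c c' by (simp add: adj_dmat[of _ n n] dmat_mult[of _ n n _ _ n])
  also have "\<dots> = dmat T (adj U * G * V)"
    using c c' mult_carrier_mat[OF c'(2) c(3)] by (subst dmat_mult[of _ n n _ _ n]) (simp_all add: T)
  finally show ?thesis
    using c U V by (subst uequiv_iff) (auto simp: unitary_dmat simp del: assoc_mult_mat)
qed

section \<open>Reduction of the dual part\<close>

lemma decouple:
  fixes s :: "nat \<Rightarrow> real"
  assumes s: "\<And>i. i < n \<Longrightarrow> s i \<ge> 0" and G: "G \<in> carrier_mat n n"
  defines "S \<equiv> dg n (\<lambda>i. complex_of_real (s i))"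
  shows "\<exists>U V G'. uequiv n U V (dmat S G) (dmat S G') \<and> G' \<in> carrier_mat n n \<and>
    (\<forall>i<n. \<forall>j<n. (s i \<noteq> s j \<longrightarrow> G' $$ (i, j) = 0) \<and>
      (s i = s j \<and> s i \<noteq> 0 \<longrightarrow> G' $$ (i, j) = cnj (G' $$ (j, i))))"
proof -
  \<comment> \<open>For \<open>s i \<noteq> s j\<close>, the \<open>(i, j)\<close> and the conjugated \<open>(j, i)\<close> entry of \<open>G - K S + S L = 0\<close> form a linear system
    for \<open>K\<^sub>i\<^sub>j\<close> and \<open>L\<^sub>i\<^sub>j\<close> with determinant \<open>\<plusminus>((s j)\<^sup>2 - (s i)\<^sup>2)\<close>. For \<open>s i = s j = 0\<close> the division
    by zero makes \<open>K\<^sub>i\<^sub>j = 0\<close>, so \<open>G\<close> stays unchanged there.\<close>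
  define K where "K = mat n n (\<lambda>(i, j).
    if s i = s j then (G $$ (i, j) - cnj (G $$ (j, i))) / (2 * s i)
    else (G $$ (i, j) * s j + s i * cnj (G $$ (j, i))) / ((s j)\<^sup>2 - (s i)\<^sup>2))"
  define L where "L = mat n n (\<lambda>(i, j). if s i = s j then 0
    else (G $$ (i, j) * s i + s j * cnj (G $$ (j, i))) / ((s j)\<^sup>2 - (s i)\<^sup>2))"
  have neg: "x / (a - b) = - (x / (b - a))" for x a b :: complex
    by (metis minus_diff_eq minus_divide_right)
  have neg2: "(x - y) / a = - ((y - x) / a)" for x y a :: complex
    by (metis minus_diff_eq minus_divide_left)
  have K: "K \<in> carrier_mat n n" by (simp add: K_def)
  have L: "L \<in> carrier_mat n n" by (simp add: L_def)
  have K_skew: "cnj (K $$ (j, i)) = - K $$ (i, j)" and L_skew: "cnj (L $$ (j, i)) = - L $$ (i, j)"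
    if ij: "i < n" "j < n" for i j
  proof -
    show "cnj (K $$ (j, i)) = - K $$ (i, j)"
    proof (cases "s i = s j")
      case True
      then have "cnj (K $$ (j, i)) = (cnj (G $$ (j, i)) - G $$ (i, j)) / (2 * s i)"
        using ij by (simp add: K_def)
      also have "\<dots> = - ((G $$ (i, j) - cnj (G $$ (j, i))) / (2 * s i))" by (rule neg2)
      finally show ?thesis using True ij by (simp add: K_def)
    next
      case False
      then have "cnj (K $$ (j, i)) = (G $$ (i, j) * s j + s i * cnj (G $$ (j, i))) / ((s i)\<^sup>2 - (s j)\<^sup>2)"
        using ij by (simp add: K_def ac_simps)
      also have "\<dots> = - ((G $$ (i, j) * s j + s i * cnj (G $$ (j, i))) / ((s j)\<^sup>2 - (s i)\<^sup>2))"
        unfolding of_real_diff by (rule neg)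
      finally show ?thesis using False ij by (simp add: K_def)
    qed
    show "cnj (L $$ (j, i)) = - L $$ (i, j)"
    proof (cases "s i = s j")
      case False
      then have "cnj (L $$ (j, i)) = (G $$ (i, j) * s i + s j * cnj (G $$ (j, i))) / ((s i)\<^sup>2 - (s j)\<^sup>2)"
        using ij by (simp add: L_def ac_simps)
      also have "\<dots> = - ((G $$ (i, j) * s i + s j * cnj (G $$ (j, i))) / ((s j)\<^sup>2 - (s i)\<^sup>2))"
        unfolding of_real_diff by (rule neg)
      finally show ?thesis using False ij by (simp add: L_def)
    qed (use ij in \<open>simp add: L_def\<close>)
  qed
  have "adj K = - K" using K by (intro eq_matI) (simp_all add: K_skew)
  note K = K this
  have "adj L = - L" using L by (intro eq_matI) (simp_all add: L_skew)
  note L = L this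
  have S: "S \<in> carrier_mat n n" by (simp add: S_def)
  \<comment> \<open>The new dual part, read off from
    \<open>(I - K \<epsilon>) (S + G \<epsilon>) (I + L \<epsilon>)\<close>.\<close>
  define G' where "G' = S * L + (G - K * S)"
  have KS: "K * S \<in> carrier_mat n n" "S * L \<in> carrier_mat n n" using K L S by (auto intro: mult_carrier_mat)
  have "adj (dmat (1\<^sub>m n) K) * dmat S G * dmat (1\<^sub>m n) L = dmat S G'"
  proof -
    have "adj (dmat (1\<^sub>m n) K) * dmat S G = dmat S (G - K * S)"
      using K S G KS by (simp add: adj_dmat[of _ n n] dmat_mult[of _ n n _ _ n] add_uminus_minus_mat[of _ n n])
    moreover have "G - K * S \<in> carrier_mat n n" by (rule minus_carrier_mat[OF KS(1)])
    ultimately show ?thesis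
      using S L(1) KS G by (simp add: dmat_mult[of _ n n _ _ n] G'_def)
  qed
  then have "uequiv n (dmat (1\<^sub>m n) K) (dmat (1\<^sub>m n) L) (dmat S G) (dmat S G')"
    using K L S by (subst uequiv_iff) (auto simp: unitary_one_plus_skew)
  moreover have G': "G' \<in> carrier_mat n n" unfolding G'_def by (intro add_carrier_mat minus_carrier_mat KS G)
  moreover have e: "G' $$ (i, j) = s i * L $$ (i, j) + (G $$ (i, j) - K $$ (i, j) * s j)"
    if "i < n" "j < n" for i j
    using that KS G K L by (simp add: G'_def S_def dg_mult_left[of _ n n] dg_mult_right[of _ n n] del: index_mult_mat(1))
  have "G' $$ (i, j) = 0" if "i < n" "j < n" "s i \<noteq> s j" for i j
  proof -
    \<comment> \<open>Distinct nonnegative values have distinct squares, so the denominator in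
      \<open>K\<close> and \<open>L\<close> is not zero.\<close>
    have "(s j)\<^sup>2 \<noteq> (s i)\<^sup>2" using s[OF that(1)] s[OF that(2)] that(3) by (simp add: power2_eq_iff_nonneg)
    then have "complex_of_real ((s j)\<^sup>2 - (s i)\<^sup>2) \<noteq> 0" by (simp only: of_real_eq_0_iff)
    then have "(complex_of_real (s j))\<^sup>2 - (complex_of_real (s i))\<^sup>2 \<noteq> 0" by simp
    define x y D where "x = G $$ (i, j) * s i + s j * cnj (G $$ (j, i))"
      and "y = G $$ (i, j) * s j + s i * cnj (G $$ (j, i))" and "D = (complex_of_real (s j))\<^sup>2 - (complex_of_real (s i))\<^sup>2"
    have "G' $$ (i, j) = s i * (x / D) + (G $$ (i, j) - y / D * s j)"
      using that by (simp add: e K_def L_def x_def y_def D_def)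
    also have "\<dots> = G $$ (i, j) + (s i * x - y * s j) / D"
      by (simp add: diff_divide_distrib)
    also have "s i * x - y * s j = - G $$ (i, j) * D"
      by (simp add: x_def y_def D_def algebra_simps power2_eq_square)
    also have "G $$ (i, j) + - G $$ (i, j) * D / D = 0"
      using \<open>(complex_of_real (s j))\<^sup>2 - _ \<noteq> 0\<close> by (simp add: D_def)
    finally show ?thesis .
  qed
  moreover have "G' $$ (i, j) = cnj (G' $$ (j, i))" if "i < n" "j < n" "s i = s j" "s i \<noteq> 0" for i j
  proof -
    \<comment> \<open>Within a group of equal positive values, \<open>K\<close> removes the
      skew-Hermitian half of \<open>G\<close> and leaves the Hermitian half.\<close>
    have "G' $$ (a, b) = (G $$ (a, b) + cnj (G $$ (b, a))) / 2" if ab: "a < n" "b < n" "s a = s b" "s a \<noteq> 0" for a b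
    proof -
      have "G' $$ (a, b) = G $$ (a, b) - (G $$ (a, b) - cnj (G $$ (b, a))) / (2 * s b) * s b"
        using ab by (simp add: e K_def L_def)
      also have "(G $$ (a, b) - cnj (G $$ (b, a))) / (2 * s b) * s b = (G $$ (a, b) - cnj (G $$ (b, a))) / 2"
        using ab by simp
      finally show ?thesis by (simp add: diff_divide_distrib add_divide_distrib)
    qed
    from this[OF that] this[OF that(2,1)] that
    have "G' $$ (i, j) = (G $$ (i, j) + cnj (G $$ (j, i))) / 2" "G' $$ (j, i) = (G $$ (j, i) + cnj (G $$ (i, j))) / 2"
      by metis+
    then show ?thesis by (simp only: complex_cnj_divide complex_cnj_add complex_cnj_cnj complex_cnj_numeral add.commute)
  qed
  ultimately show ?thesis by blast
qed

lemma hermitian_pair_diag: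
  fixes s :: "nat \<Rightarrow> real"
  assumes s: "\<And>i. i < n \<Longrightarrow> s i > 0" and G: "G \<in> carrier_mat n n"
    and comm: "\<And>i j. i < n \<Longrightarrow> j < n \<Longrightarrow> s i \<noteq> s j \<Longrightarrow> G $$ (i, j) = 0"
    and herm: "adj G = G"
  defines "S \<equiv> dg n (\<lambda>i. complex_of_real (s i))"
  shows "\<exists>W p q. uequiv n W W (dmat S G) (dmat (dg n (\<lambda>i. complex_of_real (p i))) (dg n (\<lambda>i. complex_of_real (q i))))
    \<and> (\<forall>i<n. p i > 0)"
proof -
  have S: "S \<in> carrier_mat n n" by (simp add: S_def)
  have aS: "adj S = S" by (rule eq_matI) (auto simp: S_def)
  \<comment> \<open>Since \<open>S\<close> and \<open>G\<close> commute, \<open>T\<close> is normal; diagonalising it diagonalises its Hermitian and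
    skew-Hermitian parts simultaneously.\<close>
  define T where "T = S + \<i> \<cdot>\<^sub>m G"
  have T: "T \<in> carrier_mat n n" using S G by (auto simp: T_def)
  have "G = adj G" by (simp add: herm)
  then have hG: "cnj (G $$ (j, i)) = G $$ (i, j)" if "i < n" "j < n" for i j
    using that G index_adj[of i G j] by (metis carrier_matD complex_cnj_cnj conjugate_complex_def)
  \<comment> \<open>In this form, normality of \<open>T\<close> reduces to its commuting with
    \<open>2 \<cdot>\<^sub>m S\<close>.\<close>
  have aT: "adj T = (2 \<cdot>\<^sub>m S) - T"
    using S G by (intro eq_matI) (auto simp: T_def S_def hG)
  have S2: "2 \<cdot>\<^sub>m S \<in> carrier_mat n n" "2 \<cdot>\<^sub>m S = dg n (\<lambda>i. complex_of_real (2 * s i))" using S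
    by (auto simp: S_def intro!: eq_matI)
  have "T * (2 \<cdot>\<^sub>m S) = (2 \<cdot>\<^sub>m S) * T"
  proof (rule eq_matI)
    fix i j assume "i < dim_row (2 \<cdot>\<^sub>m S * T)" "j < dim_col (2 \<cdot>\<^sub>m S * T)"
    then have ij: "i < n" "j < n" using S T by auto
    \<comment> \<open>Entry by entry, either the scalings from the two sides agree or the entry is
      zero.\<close>
    have "T $$ (i, j) = 0" if "s i \<noteq> s j" using that ij comm[OF ij that] S G by (auto simp: T_def S_def)
    then show "(T * (2 \<cdot>\<^sub>m S)) $$ (i, j) = (2 \<cdot>\<^sub>m S * T) $$ (i, j)"
      unfolding S2(2) using ij T by (cases "s i = s j") (auto simp: dg_mult_left[of _ n n] dg_mult_right[of _ n n] simp del: index_mult_mat(1))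
  qed (use S T in auto)
  then have "T * adj T = adj T * T"
    unfolding aT using T S2(1) by (simp add: mult_minus_distrib_mat[of _ n n _ n] minus_mult_distrib_mat[of _ n n _ _ n])
  then obtain W f where e: "uequiv n W W T (dg n f)" using normal_spectral[OF T] by auto
  then have W: "unitary n W" and f: "dg n f = adj W * T * W" using uequiv_iff[OF T] by blast+
  note c = unitaryD(1,2)[OF W] S G
  define S' where "S' = adj W * S * W"
  define G' where "G' = adj W * G * W"
  have c': "S' \<in> carrier_mat n n" "G' \<in> carrier_mat n n" "adj W * S \<in> carrier_mat n n" "adj W * G \<in> carrier_mat n n"
    using c by (auto simp: S'_def G'_def mult_carrier_mat[of _ n n _ n])
  have "adj S' = S'" "adj G' = G'"
    using c herm aS by (auto simp: S'_def G'_def adj_mult[of _ n n _ n] assoc_mult_mat[of _ n n _ n _ n] mult_carrier_mat[of _ n n _ n])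
  then have h: "cnj (S' $$ (j, i)) = S' $$ (i, j)" "cnj (G' $$ (j, i)) = G' $$ (i, j)" if "i < n" "j < n" for i j
    using that c' index_adj[of i S' j] index_adj[of i G' j] by (metis carrier_matD conjugate_complex_def)+
  have fS: "dg n f = S' + \<i> \<cdot>\<^sub>m G'"
    unfolding f T_def S'_def G'_def
    using c c' by (simp add: mult_add_distrib_mat[of _ n n _ n] add_mult_distrib_mat[of _ n n _ _ n] mult_smult_distrib[of _ n n _ n]
        mult_smult_assoc_mat[of _ n n _ n])
  have fij: "(if i = j then f i else 0) = S' $$ (i, j) + \<i> * G' $$ (i, j)" if "i < n" "j < n" for i j
    using that c' arg_cong[OF fS, of "\<lambda>M. M $$ (i, j)"] by auto
  \<comment> \<open>Off the diagonal, the \<open>(i, j)\<close> entry of \<open>fS\<close> and the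
    conjugate of its \<open>(j, i)\<close> entry say that \<open>S' + \<i> G'\<close> and
    \<open>S' - \<i> G'\<close> both vanish at \<open>(i, j)\<close>.\<close>
  have z: "S' $$ (i, j) = 0 \<and> G' $$ (i, j) = 0" if "i < n" "j < n" "i \<noteq> j" for i j
  proof -
    have 1: "S' $$ (i, j) + \<i> * G' $$ (i, j) = 0" using fij[of i j] that by simp
    have "cnj (S' $$ (j, i) + \<i> * G' $$ (j, i)) = 0" using fij[of j i] that by simp
    then have 2: "S' $$ (i, j) - \<i> * G' $$ (i, j) = 0" using that by (simp add: h)
    have "2 * S' $$ (i, j) = 0" using 1 2 by (metis add.left_neutral add_diff_cancel_right' diff_add_cancel eq_iff_diff_eq_0 mult_2)
    then show ?thesis using 1 by auto
  qed
  define p where "p i = Re (S' $$ (i, i))" for i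
  define q where "q i = Re (G' $$ (i, i))" for i
  have r: "S' $$ (i, i) = of_real (p i)" "G' $$ (i, i) = of_real (q i)" if "i < n" for i
    using h[OF that that] by (auto simp: p_def q_def complex_eq_iff)
  have SG: "S' = dg n (\<lambda>i. complex_of_real (p i))" "G' = dg n (\<lambda>i. complex_of_real (q i))"
    using c' z r by (auto intro!: eq_matI)
  \<comment> \<open>The value \<open>p i\<close> is the mean of the positive \<open>s k\<close>,
    weighted by the squared moduli in a unit column of \<open>W\<close>.\<close>
  have "p i > 0" if i: "i < n" for i
  proof -
    have "of_real (p i) = (adj W * S * W) $$ (i, i)" using r i by (simp add: S'_def)
    also have "\<dots> = (\<Sum>k<n. (adj W * S) $$ (i, k) * W $$ (k, i))"
      using c i by (simp add: scalar_prod_def lessThan_atLeast0)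
    also have "\<dots> = (\<Sum>k<n. complex_of_real (s k * (cmod (W $$ (k, i)))\<^sup>2))"
    proof (intro sum.cong refl)
      fix k assume "k \<in> {..<n}"
      then have k: "k < n" by simp
      have "(adj W * S) $$ (i, k) * W $$ (k, i) = cnj (W $$ (k, i)) * of_real (s k) * W $$ (k, i)"
        unfolding S_def using dg_mult_right[OF c(2) i k] c i k by (simp del: index_mult_mat(1))
      also have "\<dots> = of_real (s k) * (W $$ (k, i) * cnj (W $$ (k, i)))" by (simp add: ac_simps)
      finally show "(adj W * S) $$ (i, k) * W $$ (k, i) = complex_of_real (s k * (cmod (W $$ (k, i)))\<^sup>2)"
        by (simp only: of_real_mult complex_norm_square)
    qed
    finally have pi: "p i = (\<Sum>k<n. s k * (cmod (W $$ (k, i)))\<^sup>2)" by (simp only: of_real_eq_iff flip: of_real_sum)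
    have nn: "s k * (cmod (W $$ (k, i)))\<^sup>2 \<ge> 0" if "k < n" for k using s[OF that] by simp
    have "p i \<noteq> 0"
    proof
      assume "p i = 0"
      then have "\<forall>k<n. s k * (cmod (W $$ (k, i)))\<^sup>2 = 0"
        unfolding pi by (subst (asm) sum_nonneg_eq_0_iff) (auto simp: nn)
      then have "\<forall>k<n. (cmod (W $$ (k, i)))\<^sup>2 = 0" using s by fastforce
      then show False using sum_cmod_unitary_col[OF W i] by simp
    qed
    moreover have "p i \<ge> 0" unfolding pi using nn by (intro sum_nonneg) auto
    ultimately show ?thesis by simp
  qed
  moreover have "uequiv n W W S S'" unfolding S'_def by (rule uequiv_conj[OF W W S])
  then have "uequiv n (dmat W (0\<^sub>m n n)) (dmat W (0\<^sub>m n n)) (dmat S G) (dmat S' G')"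
    unfolding G'_def by (rule uequiv_dmat[OF _ S G])
  ultimately show ?thesis unfolding SG by blast
qed

section \<open>Existence of the dual singular value decomposition\<close>

lemma dc_adjoint_eq: "dc_adjoint A = adj A"
  by (simp add: dc_adjoint_def adj_def)

lemma dc_unitary_iff: "U \<in> carrier_mat n n \<Longrightarrow> dc_unitary U \<longleftrightarrow> unitary n U"
  unfolding dc_unitary_def unitary_def dc_adjoint_eq by (simp add: carrier_matD)

lemma is_dc_svd_iff:
  assumes A: "A \<in> carrier_mat n n" and r: "r \<le> n"
    and S: "S1 \<in> carrier_mat r r" "S2 \<in> carrier_mat (n - r) (n - r)"
  shows "is_dc_svd A U S1 S2 V \<longleftrightarrow> uequiv n U V A (bdiag S1 S2) \<and>
    diagonal_mat S1 \<and> (\<forall>i<r. positive_appreciable (S1 $$ (i, i))) \<and>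
    diagonal_mat S2 \<and> (\<forall>i<n - r. positive_infinitesimal (S2 $$ (i, i)) \<or> S2 $$ (i, i) = 0)"
proof -
  have d: "dim_row A = n" "dim_col A = n" "dim_row S1 = r" "dim_col S1 = r" "dim_row S2 = n - r" "dim_col S2 = n - r"
    using A S by auto
  have c: "bdiag S1 S2 \<in> carrier_mat n n"
    using r d by (intro carrier_matI) auto
  have u: "unitary n W \<longleftrightarrow> W \<in> carrier_mat n n \<and> dc_unitary W" for W
    using dc_unitary_iff[of W n] unitaryD(1)[of n W] by blast
  show ?thesis
    unfolding is_dc_svd_def uequiv_def Let_def dc_adjoint_eq d min.idem u using r S c[unfolded d] by blast
qed

theorem dc_svd_exists:
  assumes A: "A \<in> carrier_mat n n"
  shows "\<exists>U S1 S2 V. is_dc_svd A U S1 S2 V"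
proof -
  define S0 where "S0 = map_mat std_part A"
  define G0 where "G0 = map_mat dual_part A"
  have c0: "S0 \<in> carrier_mat n n" "G0 \<in> carrier_mat n n" using A by (auto simp: S0_def G0_def)
  have A0: "A = dmat S0 G0" unfolding S0_def G0_def by (rule dmat_parts)
  obtain U0 V0 r s where s: "uequiv n U0 V0 S0 (dg n (\<lambda>i. complex_of_real (s i)))" "r \<le> n"
    "\<forall>i<r. s i > 0" "\<forall>i\<ge>r. s i = 0" using complex_svd[OF c0(1)] by blast
  define S where "S = dg n (\<lambda>i. complex_of_real (s i))"
  define k where "k = n - r"
  have n: "n = r + k" using s by (simp add: k_def)
  have s0: "s i \<ge> 0" for i using s by (metis leI less_eq_real_def)
  note u0 = unitaryD[of n U0] unitaryD[of n V0]
  have G1: "adj U0 * G0 * V0 \<in> carrier_mat n n"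
    using s(1) u0 c0 by (auto simp: uequiv_def mult_carrier_mat[of _ n n _ n])
  obtain U1 V1 G where G: "uequiv n U1 V1 (dmat S (adj U0 * G0 * V0)) (dmat S G)" "G \<in> carrier_mat n n"
    and G0': "\<And>i j. i < n \<Longrightarrow> j < n \<Longrightarrow> s i \<noteq> s j \<Longrightarrow> G $$ (i, j) = 0"
    and Gh: "\<And>i j. i < n \<Longrightarrow> j < n \<Longrightarrow> s i = s j \<Longrightarrow> s i \<noteq> 0 \<Longrightarrow> G $$ (i, j) = cnj (G $$ (j, i))"
    using decouple[of n s, OF s0 G1] unfolding S_def by blast
  define G11 where "G11 = mat r r (\<lambda>(i, j). G $$ (i, j))"
  define G22 where "G22 = mat k k (\<lambda>(i, j). G $$ (r + i, r + j))"
  have c1: "G11 \<in> carrier_mat r r" "G22 \<in> carrier_mat k k" by (auto simp: G11_def G22_def)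
  have blocks: "dmat S G = bdiag (dmat (dg r (\<lambda>i. complex_of_real (s i))) G11) (dmat (0\<^sub>m k k) G22)"
  proof (rule eq_matI)
    fix i j
    assume "i < dim_row (bdiag (dmat (dg r (\<lambda>i. complex_of_real (s i))) G11) (dmat (0\<^sub>m k k) G22))"
      "j < dim_col (bdiag (dmat (dg r (\<lambda>i. complex_of_real (s i))) G11) (dmat (0\<^sub>m k k) G22))"
    then have ij: "i < r + k" "j < r + k" by auto
    \<comment> \<open>Across the two blocks one singular value is positive and the other
      zero.\<close>
    have off: "G $$ (i, j) = 0" if "(i < r) \<noteq> (j < r)"
    proof (rule G0')
      show "s i \<noteq> s j" using that s(3,4) by (metis less_irrefl not_less)
    qed (use ij n in auto)
    have sr: "s a = 0" if "\<not> a < r" for a using s(4) that by simp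
    show "dmat S G $$ (i, j) = bdiag (dmat (dg r (\<lambda>i. complex_of_real (s i))) G11) (dmat (0\<^sub>m k k) G22) $$ (i, j)"
      using ij off by (auto simp: S_def n G11_def G22_def zero_dcomplex_def sr)
  qed (auto simp: S_def n)
  have "G11 $$ (i, j) = 0" if "i < r" "j < r" "s i \<noteq> s j" for i j
    using that G0'[of i j] n by (simp add: G11_def)
  moreover have "adj G11 = G11"
  proof (rule eq_matI)
    fix i j assume "i < dim_row G11" "j < dim_col G11"
    then have ij: "i < r" "j < r" by (auto simp: G11_def)
    \<comment> \<open>For equal values this is \<open>Gh\<close>; for different ones both entries
      vanish.\<close>
    have "G $$ (i, j) = cnj (G $$ (j, i))"
    proof (cases "s i = s j")
      case True
      then show ?thesis using ij n s(3) Gh[of i j] by fastforce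
    next
      case False
      then show ?thesis using ij n G0'[of i j] G0'[of j i] by auto
    qed
    then show "adj G11 $$ (i, j) = G11 $$ (i, j)" using ij by (simp add: G11_def)
  qed (auto simp: G11_def)
  ultimately obtain W p q where W: "uequiv r W W (dmat (dg r (\<lambda>i. complex_of_real (s i))) G11)
      (dmat (dg r (\<lambda>i. complex_of_real (p i))) (dg r (\<lambda>i. complex_of_real (q i))))"
    and p: "\<forall>i<r. p i > 0"
    using hermitian_pair_diag[of r s G11] s(3) c1 by blast
  obtain U2 V2 r2 t where t: "uequiv k U2 V2 G22 (dg k (\<lambda>i. complex_of_real (t i)))"
    and t2: "\<forall>i<r2. t i > 0" "\<forall>i\<ge>r2. t i = 0" using complex_svd[OF c1(2)] by blast
  have UV2: "unitary k U2" "unitary k V2" and G22: "dg k (\<lambda>i. complex_of_real (t i)) = adj U2 * G22 * V2"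
    using t uequiv_iff[OF c1(2)] by blast+
  \<comment> \<open>Every pair of unitary matrices preserves a zero standard part, so the pair that
    diagonalises \<open>G22\<close> may be used on the second block.\<close>
  have "uequiv k U2 V2 (0\<^sub>m k k) (0\<^sub>m k k)"
    using UV2 unitaryD[of k U2] unitaryD[of k V2] by (auto simp: uequiv_def)
  from uequiv_dmat[OF this _ c1(2)] obtain U3 V3 where
    e3: "uequiv k U3 V3 (dmat (0\<^sub>m k k) G22) (dmat (0\<^sub>m k k) (dg k (\<lambda>i. complex_of_real (t i))))"
    unfolding G22 by auto
  define S1 where "S1 = dmat (dg r (\<lambda>i. complex_of_real (p i))) (dg r (\<lambda>i. complex_of_real (q i)))"
  define S2 where "S2 = dmat (0\<^sub>m k k) (dg k (\<lambda>i. complex_of_real (t i)))"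
  have "uequiv n (bdiag W U3) (bdiag W V3) (dmat S G) (bdiag S1 S2)"
    unfolding blocks n S1_def S2_def by (rule uequiv_bdiag[OF W e3])
  from uequiv_trans[OF G(1) this] uequiv_trans[OF uequiv_dmat[OF s(1) c0]]
  obtain U V where UV: "uequiv n U V A (bdiag S1 S2)" unfolding A0 S_def by blast
  have t0: "t i \<ge> 0" for i using t2 by (metis leI less_eq_real_def)
  have "is_dc_svd A U S1 S2 V"
  proof (subst is_dc_svd_iff[OF A, of r])
    show "uequiv n U V A (bdiag S1 S2) \<and> diagonal_mat S1 \<and>
      (\<forall>i<r. positive_appreciable (S1 $$ (i, i))) \<and> diagonal_mat S2 \<and>
      (\<forall>i<n - r. positive_infinitesimal (S2 $$ (i, i)) \<or> S2 $$ (i, i) = 0)"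
      using UV p t0 n
      by (auto simp: S1_def S2_def diagonal_mat_def positive_appreciable_def positive_infinitesimal_def
          is_dual_number_def zero_dcomplex_def less_eq_real_def)
  qed (use n in \<open>auto simp: S1_def S2_def\<close>)
  then show ?thesis by blast
qed

section \<open>Essential part and NDMPI\<close>

definition infinitesimal_mat :: "dcmat \<Rightarrow> bool" where
  "infinitesimal_mat F \<longleftrightarrow> (\<forall>i<dim_row F. \<forall>j<dim_col F. std_part (F $$ (i, j)) = 0)"

text \<open>Every summand of an entry has two factors with zero standard part, and
  \<open>\<epsilon>\<close> squares to zero.\<close>

lemma infinitesimal_mult:
  assumes "infinitesimal_mat F" "infinitesimal_mat G" "F \<in> carrier_mat n m" "G \<in> carrier_mat m k"
  shows "F * G = 0\<^sub>m n k"
proof (rule eq_matI)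
  fix i j assume "i < dim_row (0\<^sub>m n k)" "j < dim_col (0\<^sub>m n k)"
  then have ij: "i < n" "j < k" by auto
  have "std_part (F $$ (i, a)) = 0" "std_part (G $$ (a, j)) = 0" if "a < m" for a
    using that ij assms by (auto simp: infinitesimal_mat_def)
  then show "(F * G) $$ (i, j) = 0\<^sub>m n k $$ (i, j)"
    using ij assms(3,4) by (auto simp: scalar_prod_def intro!: dcomplex.expand)
qed (use assms in auto)

lemma infinitesimal_mult_left:
  assumes "infinitesimal_mat F" "F \<in> carrier_mat m k" "G \<in> carrier_mat n m"
  shows "infinitesimal_mat (G * F)"
  using assms by (auto simp: infinitesimal_mat_def scalar_prod_def)

lemma infinitesimal_mult_right:
  assumes "infinitesimal_mat F" "F \<in> carrier_mat n m" "G \<in> carrier_mat m k"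
  shows "infinitesimal_mat (F * G)"
  using assms by (auto simp: infinitesimal_mat_def scalar_prod_def)

lemma infinitesimal_minus:
  "infinitesimal_mat F \<Longrightarrow> infinitesimal_mat G \<Longrightarrow> F \<in> carrier_mat n m \<Longrightarrow> G \<in> carrier_mat n m \<Longrightarrow>
    infinitesimal_mat (F - G)"
  by (auto simp: infinitesimal_mat_def)

lemma infinitesimal_adj: "infinitesimal_mat F \<Longrightarrow> infinitesimal_mat (adj F)"
  by (auto simp: infinitesimal_mat_def)

section \<open>Splitting off the essential part\<close>

text \<open>Describes the essential part \<open>E\<close> by equations instead of a decomposition:
  \<open>F\<close> is an infinitesimal remainder orthogonal to \<open>E\<close> on both sides, and
  \<open>X\<close> is the Moore-Penrose inverse of \<open>E\<close>. These conditions determine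
  \<open>E\<close>, so all decompositions yield the same essential part.\<close>

definition ess_split :: "nat \<Rightarrow> dcmat \<Rightarrow> dcmat \<Rightarrow> dcmat \<Rightarrow> dcmat \<Rightarrow> bool" where
  "ess_split n A E F X \<longleftrightarrow> E \<in> carrier_mat n n \<and> F \<in> carrier_mat n n \<and> X \<in> carrier_mat n n \<and>
    A = E + F \<and> infinitesimal_mat F \<and> adj E * F = 0\<^sub>m n n \<and> F * adj E = 0\<^sub>m n n \<and>
    E * X * E = E \<and> X * E * X = X \<and> adj (E * X) = E * X \<and> adj (X * E) = X * E"

text \<open>Up to the unitary factors, \<open>E\<close>, \<open>F\<close> and \<open>X\<close> are
  block-diagonal with blocks \<open>S1, 0\<close>, then \<open>0, S2\<close>, then the inverse of
  \<open>S1\<close> and \<open>0\<close>; the equations hold block by block.\<close>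

lemma ess_split_from_svd:
  assumes A: "A \<in> carrier_mat n n" and svd: "is_dc_svd A U S1 S2 V" and r: "dim_row S1 = r"
    and k: "k = n - r"
  shows "\<exists>F X. ess_split n A (U * bdiag S1 (0\<^sub>m k k) * adj V) F X"
proof -
  have S: "r \<le> n" "S1 \<in> carrier_mat r r" "S2 \<in> carrier_mat k k"
    using A svd r k by (auto simp: is_dc_svd_def Let_def)
  have n: "n = r + k" using S k by simp
  have e: "uequiv n U V A (bdiag S1 S2)" and d1: "diagonal_mat S1" and pa: "\<And>i. i < r \<Longrightarrow> positive_appreciable (S1 $$ (i, i))"
    and d2: "diagonal_mat S2" and pi: "\<And>i. i < k \<Longrightarrow> positive_infinitesimal (S2 $$ (i, i)) \<or> S2 $$ (i, i) = 0"
    using svd is_dc_svd_iff[OF A S(1) S(2)] S(3) unfolding k by blast+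
  have U: "unitary n U" and V: "unitary n V" and AU: "A = U * bdiag S1 S2 * adj V"
    using e by (auto simp: uequiv_def)
  \<comment> \<open>The inverse of \<open>S1\<close>: for nonzero \<open>a\<close>, the inverse of
    \<open>a + b \<epsilon>\<close> is \<open>1 / a - (b / a^2) \<epsilon>\<close>.\<close>
  define Y where "Y = dg r (\<lambda>i. DC (1 / std_part (S1 $$ (i, i))) (- dual_part (S1 $$ (i, i)) / (std_part (S1 $$ (i, i)))\<^sup>2))"
  define D1 D2 Y' where "D1 = bdiag S1 (0\<^sub>m k k)" and "D2 = bdiag (0\<^sub>m r r) S2" and "Y' = bdiag Y (0\<^sub>m k k)"
  have Y: "Y \<in> carrier_mat r r" by (simp add: Y_def)
  have S1: "S1 = dg r (\<lambda>i. S1 $$ (i, i))" using d1 S by (intro eq_matI) (auto simp: diagonal_mat_def)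
  have nz: "std_part (S1 $$ (i, i)) \<noteq> 0" if "i < r" for i using pa[OF that] by (auto simp: positive_appreciable_def)
  have SY: "S1 * Y = 1\<^sub>m r"
  proof (rule eq_matI)
    fix i j assume "i < dim_row (1\<^sub>m r :: dcmat)" "j < dim_col (1\<^sub>m r :: dcmat)"
    then have ij: "i < r" "j < r" by auto
    have "(S1 * Y) $$ (i, j) = S1 $$ (i, i) * Y $$ (i, j)"
      using dg_mult_left[OF Y ij] S1 by metis
    then show "(S1 * Y) $$ (i, j) = 1\<^sub>m r $$ (i, j)"
      using ij nz[OF ij(1)] by (auto simp: Y_def power2_eq_square intro!: dcomplex.expand)
  qed (use S Y in auto)
  have YS: "Y * S1 = 1\<^sub>m r"
  proof (rule eq_matI)
    fix i j assume "i < dim_row (1\<^sub>m r :: dcmat)" "j < dim_col (1\<^sub>m r :: dcmat)"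
    then have ij: "i < r" "j < r" by auto
    have "(Y * S1) $$ (i, j) = Y $$ (i, j) * S1 $$ (j, j)"
      using dg_mult_right[OF Y ij] S1 by metis
    then show "(Y * S1) $$ (i, j) = 1\<^sub>m r $$ (i, j)"
      using ij nz[OF ij(1)] by (auto simp: Y_def power2_eq_square intro!: dcomplex.expand)
  qed (use S Y in auto)
  have aS1: "adj S1 = S1"
  proof (rule eq_matI)
    fix i j assume "i < dim_row S1" "j < dim_col S1"
    then have ij: "i < r" "j < r" using S by auto
    show "adj S1 $$ (i, j) = S1 $$ (i, j)"
    proof (cases "i = j")
      case True
      then show ?thesis using ij S pa[OF ij(1)]
        by (auto simp: positive_appreciable_def is_dual_number_def Reals_cnj_iff intro!: dcomplex.expand)
    next
      case False
      then show ?thesis using ij S d1 by (auto simp: diagonal_mat_def)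
    qed
  qed (use S in auto)
  have cD: "D1 \<in> carrier_mat n n" "D2 \<in> carrier_mat n n" "Y' \<in> carrier_mat n n"
    using S Y by (auto simp: D1_def D2_def Y'_def n)
  have mult: "bdiag P Q * bdiag P' Q' = bdiag (P * P') (Q * Q')"
    if "P \<in> carrier_mat r r" "Q \<in> carrier_mat k k" "P' \<in> carrier_mat r r" "Q' \<in> carrier_mat k k" for P Q P' Q' :: dcmat
    using that by (rule bdiag_mult)
  have aD1: "adj D1 = D1" using bdiag_adj[of S1 r "0\<^sub>m k k" k] S by (simp add: D1_def aS1)
  have bz: "bdiag (0\<^sub>m r r) (0\<^sub>m k k) = (0\<^sub>m n n :: dcmat)" by (simp add: n)
  \<comment> \<open>The projector onto the first \<open>r\<close> coordinates, the common value of
    \<open>D1 * Y'\<close> and \<open>Y' * D1\<close>.\<close>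
  define J where "J = bdiag (1\<^sub>m r) (0\<^sub>m k k :: dcmat)"
  have J: "J \<in> carrier_mat n n" "adj J = J"
    using bdiag_adj[of "1\<^sub>m r" r "0\<^sub>m k k" k] by (auto simp: J_def n)
  note zk = zero_carrier_mat[of k k] and zr = zero_carrier_mat[of r r]
  have p: "D1 * D2 = 0\<^sub>m n n" "D2 * D1 = 0\<^sub>m n n" "D1 * Y' = J" "Y' * D1 = J" "J * D1 = D1" "J * Y' = Y'"
    using S Y SY YS bz mult[OF S(2) zk zr S(3)] mult[OF zr S(3) S(2) zk] mult[OF S(2) zk Y zk] mult[OF Y zk S(2) zk]
      mult[OF one_carrier_mat zk S(2) zk] mult[OF one_carrier_mat zk Y zk]
    by (simp_all add: D1_def D2_def Y'_def J_def)
  \<comment> \<open>The inner unitary factors cancel, which reduces all products to products of the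
    middle factors.\<close>
  have chain: "(P * Q * adj P') * (P' * Q' * adj P'') = P * (Q * Q') * adj P''"
    if P: "unitary n P" "unitary n P'" "unitary n P''" and Q: "Q \<in> carrier_mat n n" "Q' \<in> carrier_mat n n" for P P' P'' Q Q' :: dcmat
  proof -
    note c = unitaryD(1,2)[OF P(1)] unitaryD(1,2)[OF P(2)] unitaryD(1,2)[OF P(3)] Q
    have "(P * Q * adj P') * (P' * Q' * adj P'') = P * (Q * (adj P' * (P' * (Q' * adj P''))))"
      using c by (simp add: assoc_mult_mat[of _ n n _ n _ n] mult_carrier_mat[of _ n n _ n])
    also have "adj P' * (P' * (Q' * adj P'')) = Q' * adj P''"
      using c by (intro unitary_cancel(1)[OF P(2), of _ n]) (auto simp: mult_carrier_mat[of _ n n _ n])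
    finally show ?thesis
      using c by (simp add: assoc_mult_mat[of _ n n _ n _ n] mult_carrier_mat[of _ n n _ n])
  qed
  have adj_chain: "adj (P * Q * adj P') = P' * adj Q * adj P"
    if P: "unitary n P" "unitary n P'" and Q: "Q \<in> carrier_mat n n" for P P' Q :: dcmat
    using unitaryD(1,2)[OF P(1)] unitaryD(1,2)[OF P(2)] Q
    by (simp add: adj_mult[of _ n n _ n] assoc_mult_mat[of _ n n _ n _ n] mult_carrier_mat[of _ n n _ n])
  define E F X where "E = U * D1 * adj V" and "F = U * D2 * adj V" and "X = V * Y' * adj U"
  note c = unitaryD(1,2)[OF U] unitaryD(1,2)[OF V] cD J
  have cE: "E \<in> carrier_mat n n" "F \<in> carrier_mat n n" "X \<in> carrier_mat n n"
    using c by (auto simp: E_def F_def X_def mult_carrier_mat[of _ n n _ n])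
  have z: "U * 0\<^sub>m n n * adj U = 0\<^sub>m n n" "V * 0\<^sub>m n n * adj V = 0\<^sub>m n n" using c by auto
  have EX: "E * X = U * J * adj U" "X * E = V * J * adj V"
    using chain[OF U V U cD(1,3)] chain[OF V U V cD(3,1)] p by (simp_all add: E_def X_def)
  have "D1 + D2 = bdiag S1 S2"
    using S by (intro eq_matI) (auto simp: D1_def D2_def)
  then have "A = E + F"
    using c by (simp add: AU E_def F_def mult_add_distrib_mat[of _ n n _ n] add_mult_distrib_mat[of _ n n _ _ n] mult_carrier_mat[of _ n n _ n]
        del: assoc_mult_mat flip: \<open>D1 + D2 = bdiag S1 S2\<close>)
  moreover have "std_part (S2 $$ (i, j)) = 0" if "i < k" "j < k" for i j
    using that d2 pi[of i] S(3) by (cases "i = j") (auto simp: diagonal_mat_def positive_infinitesimal_def)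
  then have "infinitesimal_mat D2"
    using S by (auto simp: infinitesimal_mat_def D2_def)
  then have "infinitesimal_mat F"
    unfolding F_def using c by (intro infinitesimal_mult_right[of _ n n] infinitesimal_mult_left[of _ n n]) (auto simp: mult_carrier_mat[of _ n n _ n])
  moreover have "adj E * F = 0\<^sub>m n n" "F * adj E = 0\<^sub>m n n"
    using adj_chain[OF U V cD(1)] chain[OF V U V cD(1,2)] chain[OF U V U cD(2,1)] p z by (simp_all add: E_def F_def aD1)
  moreover have "E * X * E = E" "X * E * X = X"
    unfolding EX using chain[OF U U V J(1) cD(1)] chain[OF V V U J(1) cD(3)] p by (simp_all add: E_def X_def)
  moreover have "adj (E * X) = E * X" "adj (X * E) = X * E"
    unfolding EX using adj_chain[OF U U J(1)] adj_chain[OF V V J(1)] J by simp_all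
  ultimately have "ess_split n A E F X" using cE by (simp add: ess_split_def)
  then show ?thesis unfolding E_def D1_def by blast
qed

text \<open>As \<open>X * E\<close> and \<open>E * X\<close> are Hermitian,
  \<open>X = X * E * X\<close> can be written both with a first and with a last factor
  \<open>adj E\<close>; since \<open>F\<close> is orthogonal to it, \<open>F * X\<close> and
  \<open>X * F\<close> vanish.\<close>

lemma ess_split_mult:
  assumes "ess_split n A E F X"
  shows "A * X = E * X" "X * A = X * E"
proof -
  have c: "E \<in> carrier_mat n n" "F \<in> carrier_mat n n" "X \<in> carrier_mat n n" "A = E + F"
    and z: "adj E * F = 0\<^sub>m n n" "F * adj E = 0\<^sub>m n n" and h: "X * E * X = X" "adj (E * X) = E * X" "adj (X * E) = X * E"
    using assms by (auto simp: ess_split_def)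
  note c' = c(1-3) adj_carrier[OF c(1)] adj_carrier[OF c(2)] adj_carrier[OF c(3)]
  note as = assoc_mult_mat[of _ n n _ n _ n] mult_carrier_mat[of _ n n _ n]
  have e: "adj E * adj X = X * E" "adj X * adj E = E * X"
    using h adj_mult[OF c(1,3)] adj_mult[OF c(3,1)] by simp_all
  have "F * X = F * (X * E * X)" using h by simp
  also have "\<dots> = F * adj E * adj X * X" unfolding e(1)[symmetric] using c' by (simp add: as)
  also have "\<dots> = 0\<^sub>m n n" using z c' by simp
  finally have FX: "F * X = 0\<^sub>m n n" .
  have "X * F = X * E * X * F" using h by simp
  also have "\<dots> = X * (E * X) * F" using c' by (simp add: as)
  also have "\<dots> = X * adj X * (adj E * F)" unfolding e(2)[symmetric] using c' by (simp add: as)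
  also have "\<dots> = 0\<^sub>m n n" using z c' by (simp add: as)
  finally have XF: "X * F = 0\<^sub>m n n" .
  show "A * X = E * X" using c FX by (simp add: add_mult_distrib_mat[of _ n n] as)
  show "X * A = X * E" using c XF by (simp add: mult_add_distrib_mat[of _ n n] as)
qed

lemma minus_eq_zero_mat:
  fixes A B :: "'a :: ab_group_add mat"
  assumes "A \<in> carrier_mat n m" "B \<in> carrier_mat n m" "A - B = 0\<^sub>m n m"
  shows "A = B"
proof (rule eq_matI)
  fix i j assume "i < dim_row B" "j < dim_col B"
  then show "A $$ (i, j) = B $$ (i, j)"
    using assms(1,2) arg_cong[OF assms(3), of "\<lambda>M. M $$ (i, j)"] by auto
qed (use assms in auto)

text \<open>The difference \<open>D = E - E'\<close> is infinitesimal, so \<open>D X' D = 0\<close>, and it satisfies \<open>E X D = 0\<close> and \<open>D X E = 0\<close>.\<close>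

lemma ess_split_unique:
  assumes s: "ess_split n A E F X" and s': "ess_split n A E' F' X'"
  shows "E = E'"
proof -
  have c: "E \<in> carrier_mat n n" "F \<in> carrier_mat n n" "X \<in> carrier_mat n n" "A = E + F"
    and F: "infinitesimal_mat F"
    and z: "adj E * F = 0\<^sub>m n n" "F * adj E = 0\<^sub>m n n"
    and h: "E * X * E = E" "adj (E * X) = E * X" "adj (X * E) = X * E"
    using s by (auto simp: ess_split_def)
  have c': "E' \<in> carrier_mat n n" "F' \<in> carrier_mat n n" "X' \<in> carrier_mat n n" "A = E' + F'"
    and F': "infinitesimal_mat F'"
    and z': "adj E' * F' = 0\<^sub>m n n" "F' * adj E' = 0\<^sub>m n n"
    and h': "E' * X' * E' = E'"
    using s' by (auto simp: ess_split_def)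
  note C = c(1-3) c'(1-3) adj_carrier[OF c(1)] adj_carrier[OF c(2)] adj_carrier[OF c(3)] adj_carrier[OF c'(1)]
  note as = assoc_mult_mat[of _ n n _ n _ n] mult_carrier_mat[of _ n n _ n]
  define D where "D = E - E'"
  have D: "D \<in> carrier_mat n n" using C by (auto simp: D_def intro: minus_carrier_mat)
  have DF: "D = F' - F"
  proof (rule eq_matI)
    fix i j assume "i < dim_row (F' - F)" "j < dim_col (F' - F)"
    then have ij: "i < n" "j < n" using C by auto
    have "(E + F) $$ (i, j) = (E' + F') $$ (i, j)" using c(4) c'(4) by simp
    then have "E $$ (i, j) + F $$ (i, j) = E' $$ (i, j) + F' $$ (i, j)" using C ij by simp
    then have "E $$ (i, j) - E' $$ (i, j) = F' $$ (i, j) - F $$ (i, j)" by (simp add: algebra_simps)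
    then show "D $$ (i, j) = (F' - F) $$ (i, j)" using C ij by (simp add: D_def)
  qed (use C in \<open>auto simp: D_def\<close>)
  have Di: "infinitesimal_mat D" unfolding DF using F' F C by (intro infinitesimal_minus)
  have aE: "adj E = adj E' + adj D"
    unfolding D_def adj_minus[OF C(1,4)] using C by (intro eq_matI) auto
  have aD: "adj D \<in> carrier_mat n n" using D by simp
  \<comment> \<open>Both factors are infinitesimal, so \<open>adj E'\<close> may be replaced by
    \<open>adj E\<close> in the orthogonality relations of \<open>F'\<close>.\<close>
  have i0: "adj D * F' = 0\<^sub>m n n" "F' * adj D = 0\<^sub>m n n"
    using infinitesimal_mult[OF infinitesimal_adj[OF Di] F' aD C(5)] infinitesimal_mult[OF F' infinitesimal_adj[OF Di] C(5) aD] by auto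
  have "adj E * F' = adj E' * F' + adj D * F'"
    unfolding aE by (rule add_mult_distrib_mat[OF C(10) aD C(5)])
  then have "adj E * F' = 0\<^sub>m n n" using z' i0 by simp
  then have ED: "adj E * D = 0\<^sub>m n n"
    unfolding DF using mult_minus_distrib_mat[OF C(7) C(5) C(2)] z by simp
  have "F' * adj E = F' * adj E' + F' * adj D"
    unfolding aE by (rule mult_add_distrib_mat[OF C(5) C(10) aD])
  then have "F' * adj E = 0\<^sub>m n n" using z' i0 by simp
  then have DE: "D * adj E = 0\<^sub>m n n"
    unfolding DF using minus_mult_distrib_mat[OF C(5) C(2) C(7)] z by simp
  have e: "adj E * adj X = X * E" "adj X * adj E = E * X"
    using h adj_mult[OF c(1,3)] adj_mult[OF c(3,1)] by simp_all
  have EXD: "E * X * D = 0\<^sub>m n n"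
    unfolding e(2)[symmetric] using C D ED by (simp add: as)
  have DXE: "D * (X * E) = 0\<^sub>m n n"
    unfolding e(1)[symmetric] using C D DE by (simp add: assoc_mult_mat[symmetric, of D n n "adj E" n _ n] del: assoc_mult_mat)
  have EX: "E * X \<in> carrier_mat n n" "X * E \<in> carrier_mat n n" using C by (auto simp: as)
  have EXE: "E * (X * E) = E" using h(1) assoc_mult_mat[OF C(1,3,1)] by simp
  \<comment> \<open>The projectors \<open>E * X\<close> from the left and \<open>X * E\<close> from
    the right annihilate \<open>D\<close>, so they turn \<open>E'\<close> into
    \<open>E\<close>.\<close>
  have 1: "E * X * E' = E"
  proof (rule sym, rule minus_eq_zero_mat)
    show "E - E * X * E' = 0\<^sub>m n n"
      using EXD h(1) mult_minus_distrib_mat[OF EX(1) C(1,4)] by (simp add: D_def)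
  qed (use C EX in \<open>auto simp: as\<close>)
  have 2: "E' * (X * E) = E"
  proof (rule sym, rule minus_eq_zero_mat)
    show "E - E' * (X * E) = 0\<^sub>m n n"
      using EXE DXE minus_mult_distrib_mat[OF C(1,4) EX(2)] by (simp add: D_def)
  qed (use C EX in \<open>auto simp: as\<close>)
  have "E * X' * E' = E * X * E' * X' * E'" using 1 by simp
  also have "\<dots> = E * X * (E' * X' * E')" using C by (simp add: as)
  finally have 3: "E * X' * E' = E" using h' 1 by simp
  have "E' * X' * E = E' * X' * (E' * (X * E))" using 2 by simp
  also have "\<dots> = E' * X' * E' * (X * E)" using C by (simp add: as)
  finally have 4: "E' * X' * E = E" using h' 2 by simp
  \<comment> \<open>With \<open>3\<close>, also \<open>X'\<close> is an inner inverse of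
    \<open>E\<close>.\<close>
  have "E * X' * E = E * X' * (E' * (X * E))" using 2 by simp
  also have "\<dots> = E * X' * E' * (X * E)" using C by (simp add: as)
  finally have 5: "E * X' * E = E" using 3 EXE by simp
  have DX': "D * X' \<in> carrier_mat n n" using D C by (auto simp: as)
  have EX': "E * X' \<in> carrier_mat n n" "E' * X' \<in> carrier_mat n n" using C by (auto simp: as)
  have "D * X' * D = 0\<^sub>m n n"
    by (rule infinitesimal_mult[OF infinitesimal_mult_right[OF Di D C(6)] Di DX' D])
  then have "D * X' * E - D * X' * E' = 0\<^sub>m n n"
    using mult_minus_distrib_mat[OF DX' C(1,4)] by (simp only: D_def[symmetric])
  then have 6: "D * X' * E = D * X' * E'"
    by (rule minus_eq_zero_mat[OF mult_carrier_mat[OF DX' C(1)] mult_carrier_mat[OF DX' C(4)]])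
  have dist: "D * X' * Z = E * X' * Z - E' * X' * Z" if "Z \<in> carrier_mat n n" for Z
    unfolding D_def minus_mult_distrib_mat[OF C(1,4,6)] by (rule minus_mult_distrib_mat[OF EX' that])
  \<comment> \<open>The product \<open>D * X'\<close> maps \<open>E'\<close> to
    \<open>E - E'\<close> by \<open>3\<close> and \<open>E\<close> to zero by \<open>4\<close> and
    \<open>5\<close>, while \<open>6\<close> makes the two results equal.\<close>
  have "E - E' = D * X' * E'" using dist[OF C(4)] 3 h' by simp
  also have "\<dots> = E - E" unfolding 6[symmetric] using dist[OF C(1)] 4 5 by simp
  also have "\<dots> = 0\<^sub>m n n" using C by (intro eq_matI) auto
  finally show ?thesis by (rule minus_eq_zero_mat[OF C(1,4)])
qed

text \<open>Together with \<open>ess_split_unique\<close> this makes the essential part well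
  defined.\<close>

lemma is_essential_part_split:
  assumes A: "A \<in> carrier_mat n n" and e: "is_essential_part A E"
  shows "\<exists>F X. ess_split n A E F X"
proof -
  obtain U S1 S2 V where svd: "is_dc_svd A U S1 S2 V"
    and E: "E = U * four_block_mat S1 (0\<^sub>m (dim_row S1) (n - dim_row S1)) (0\<^sub>m (n - dim_row S1) (dim_row S1)) (0\<^sub>m (n - dim_row S1) (n - dim_row S1)) * dc_adjoint V"
    using e A by (auto simp: is_essential_part_def Let_def)
  have "dim_col S1 = dim_row S1" using svd by (auto simp: is_dc_svd_def Let_def)
  then show ?thesis using ess_split_from_svd[OF A svd refl refl] E by (simp add: dc_adjoint_eq)
qed

section \<open>Uniqueness and existence of the NDMPI\<close>

text \<open>The classical argument of Penrose, with \<open>A * X * A = A * Y * A\<close> in the role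
  of \<open>A * X * A = A\<close>. The Hermitian matrices \<open>A * X\<close> and
  \<open>A * Y\<close> absorb each other, so taking adjoints makes them equal, and likewise
  \<open>X * A = Y * A\<close>; then \<open>X = X * A * Y = Y\<close>.\<close>

lemma is_ndmpi_unique:
  assumes A: "A \<in> carrier_mat n n" and X: "is_ndmpi A X" and Y: "is_ndmpi A Y"
  shows "X = Y"
proof -
  have c: "A \<in> carrier_mat n n" "X \<in> carrier_mat n n" "Y \<in> carrier_mat n n"
    using A X Y by (auto simp: is_ndmpi_def)
  note as = assoc_mult_mat[of _ n n _ n _ n] mult_carrier_mat[of _ n n _ n]
  have e: "A * X * A = A * Y * A" "X * A * X = X" "Y * A * Y = Y"
    "adj (A * X) = A * X" "adj (A * Y) = A * Y" "adj (X * A) = X * A" "adj (Y * A) = Y * A"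
    using X Y by (auto simp: is_ndmpi_def dc_adjoint_eq)
  have "A * X * (A * Y) = A * X * A * Y" using c by (simp add: as)
  also have "\<dots> = A * (Y * A * Y)" unfolding e(1) using c by (simp add: as)
  finally have 1: "A * X * (A * Y) = A * Y" using e by simp
  have "A * Y * (A * X) = A * Y * A * X" using c by (simp add: as)
  also have "\<dots> = A * (X * A * X)" unfolding e(1)[symmetric] using c by (simp add: as)
  finally have 2: "A * Y * (A * X) = A * X" using e by simp
  have "A * X = adj (A * Y * (A * X))" using 2 e by simp
  also have "\<dots> = A * X * (A * Y)" using adj_mult[of "A * Y" n n "A * X" n] c e by (simp add: as del: assoc_mult_mat)
  finally have AX: "A * X = A * Y" using 1 by simp
  have "X * A * (Y * A) = X * (A * Y * A)" using c by (simp add: as)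
  also have "\<dots> = X * A * X * A" unfolding e(1)[symmetric] using c by (simp add: as)
  finally have 3: "X * A * (Y * A) = X * A" using e by simp
  have "Y * A * (X * A) = Y * (A * X * A)" using c by (simp add: as)
  also have "\<dots> = Y * A * Y * A" unfolding e(1) using c by (simp add: as)
  finally have 4: "Y * A * (X * A) = Y * A" using e by simp
  have "X * A = adj (X * A * (Y * A))" using 3 e by simp
  also have "\<dots> = Y * A * (X * A)" using adj_mult[of "X * A" n n "Y * A" n] c e by (simp add: as del: assoc_mult_mat)
  finally have XA: "X * A = Y * A" using 4 by simp
  have "X = X * (A * X)" using e(2) c by (simp add: as)
  also have "\<dots> = X * A * Y" unfolding AX using c by (simp add: as)
  also have "\<dots> = Y" unfolding XA by (rule e(3))
  finally show ?thesis .
qed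

text \<open>The \<open>X\<close> of an essential splitting works: by \<open>ess_split_mult\<close>,
  its products with \<open>A\<close> are those with \<open>E\<close>, so the Moore-Penrose equations
  of \<open>E\<close> carry over.\<close>

lemma is_ndmpi_exists:
  assumes A: "A \<in> carrier_mat n n"
  shows "\<exists>X. is_ndmpi A X"
proof -
  obtain E where E: "is_essential_part A E"
    using dc_svd_exists[OF A] unfolding is_essential_part_def Let_def by blast
  then obtain F X where s: "ess_split n A E F X" using is_essential_part_split[OF A] by blast
  have "essential_part A = E"
    unfolding essential_part_def
    using E ess_split_unique s is_essential_part_split[OF A] by (intro the_equality) blast+
  moreover have "A * X * A = E * (X * A)" "X * A * X = X * E * X"
    using s A ess_split_mult[OF s] assoc_mult_mat[of E n n X n A n] by (auto simp: ess_split_def)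
  ultimately have "is_ndmpi A X"
    using s A ess_split_mult[OF s] by (auto simp: is_ndmpi_def ess_split_def dc_adjoint_eq)
  then show ?thesis ..
qed

lemma ndmpi_eqI:
  "A \<in> carrier_mat n n \<Longrightarrow> is_ndmpi A X \<Longrightarrow> ndmpi A = X"
  unfolding ndmpi_def using is_ndmpi_unique by (intro the_equality) blast+

lemma is_ndmpi_ndmpi:
  assumes "A \<in> carrier_mat n n" shows "is_ndmpi A (ndmpi A)"
  using is_ndmpi_exists[OF assms] ndmpi_eqI[OF assms] by metis

section \<open>The reverse order law\<close>

text \<open>The determinant of \<open>A\<close> is a unit, so the adjugate \<open>adj_mat A\<close>
  (not the conjugate transpose \<open>adj\<close>) yields a left inverse, which must equal the right
  inverse \<open>B\<close>.\<close>

lemma mat_left_right_inverse: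
  fixes A B :: "'a :: comm_ring_1 mat"
  assumes A: "A \<in> carrier_mat n n" and B: "B \<in> carrier_mat n n" and AB: "A * B = 1\<^sub>m n"
  shows "B * A = 1\<^sub>m n"
proof -
  have d: "det B * det A = 1" using det_mult[OF A B] AB by (simp add: mult.commute)
  define Z where "Z = det B \<cdot>\<^sub>m adj_mat A"
  have Z: "Z \<in> carrier_mat n n" using adj_mat(1)[OF A] by (simp add: Z_def)
  have ZA: "Z * A = 1\<^sub>m n"
    using adj_mat[OF A] A d by (simp add: Z_def mult_smult_assoc_mat[of _ n n _ n]) (auto intro!: eq_matI)
  have "B = Z * A * B" using ZA B by simp
  also have "\<dots> = Z * (A * B)" by (rule assoc_mult_mat[OF Z A B])
  finally have "B = Z" using AB Z by simp
  then show ?thesis using ZA by simp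
qed

text \<open>No dimension argument is available over a ring. Instead, \<open>R Y R\<close> is a left inverse of \<open>A R = R A R\<close> in the
  corner of \<open>R\<close>; after adding \<open>1 - R\<close>, determinants make it a right inverse, too.\<close>

lemma inverse_preserves_range:
  fixes A Y R :: "'a :: comm_ring_1 mat"
  assumes A: "A \<in> carrier_mat n n" and Y: "Y \<in> carrier_mat n n" and R: "R \<in> carrier_mat n n"
    and YA: "Y * A = 1\<^sub>m n" and RR: "R * R = R" and inv: "R * (A * R) = A * R"
  shows "R * (Y * R) = Y * R"
proof -
  note as = assoc_mult_mat[of _ n n _ n _ n] mult_carrier_mat[of _ n n _ n]
  define T where "T = 1\<^sub>m n - R"
  define y where "y = R * (Y * R)"
  define a where "a = A * R"
  have c: "T \<in> carrier_mat n n" "y \<in> carrier_mat n n" "a \<in> carrier_mat n n" "y + T \<in> carrier_mat n n" "a + T \<in> carrier_mat n n"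
    using A Y R by (auto simp: T_def y_def a_def as intro!: minus_carrier_mat)
  have zero: "M - M = 0\<^sub>m n n" if "M \<in> carrier_mat n n" for M :: "'a mat"
    using that by (intro eq_matI) auto
  have RT: "R * T = 0\<^sub>m n n" "T * R = 0\<^sub>m n n" "T * T = T"
  proof -
    show *: "R * T = 0\<^sub>m n n" using mult_minus_distrib_mat[OF R one_carrier_mat R] R RR zero[OF R] by (simp add: T_def)
    show "T * R = 0\<^sub>m n n" using minus_mult_distrib_mat[OF one_carrier_mat R R] R RR zero[OF R] by (simp add: T_def)
    have "T * T = 1\<^sub>m n * T - R * T" unfolding T_def using R minus_carrier_mat[OF R] by (intro minus_mult_distrib_mat[of _ n n _ _ n]) auto
    also have "\<dots> = T" unfolding * using c by (intro eq_matI) auto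
    finally show "T * T = T" .
  qed
  have Ya: "Y * a = R"
    using assoc_mult_mat[OF Y A R] YA R by (simp add: a_def)
  have Ra: "R * a = a" using inv by (simp add: a_def)
  have "y * a = R * (Y * (R * a))" using A Y R c by (simp add: y_def as)
  then have ya: "y * a = R" using Ra Ya RR by simp
  have "y * T = R * (Y * (R * T))" using Y R c by (simp add: y_def as)
  then have yT: "y * T = 0\<^sub>m n n" using RT Y R by simp
  have "T * a = T * R * a" using Ra c R by (simp add: as)
  then have Ta: "T * a = 0\<^sub>m n n" using RT c by simp
  have "T * y = T * R * (Y * R)" using c Y R by (simp add: y_def as)
  then have Ty: "T * y = 0\<^sub>m n n" using RT(2) left_mult_zero_mat[OF mult_carrier_mat[OF Y R]] by simp
  have "(y + T) * (a + T) = y * a + T * a + (y * T + T * T)"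
    using c by (simp add: add_mult_distrib_mat[of _ n n _ _ n] mult_add_distrib_mat[of _ n n _ n] as)
  also have "\<dots> = 1\<^sub>m n" unfolding ya yT Ta RT using R c by (intro eq_matI) (auto simp: T_def)
  finally have 1: "(a + T) * (y + T) = 1\<^sub>m n" by (rule mat_left_right_inverse[OF c(4,5)])
  have "y * R = y" using Y R RR by (simp add: y_def as)
  then have yTR: "(y + T) * R = y" using c R RT by (simp add: add_mult_distrib_mat[of _ n n _ _ n])
  \<comment> \<open>Multiplication by \<open>R\<close> returns to the corner, where \<open>y\<close>
    is now a right inverse of \<open>a\<close>.\<close>
  have "R = (a + T) * (y + T) * R" using 1 R by simp
  also have "\<dots> = (a + T) * y" using c R by (simp only: assoc_mult_mat[OF c(5,4) R] yTR)
  also have "\<dots> = a * y" using c Ty by (simp add: add_mult_distrib_mat[of _ n n _ _ n] as)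
  finally have ay: "R = a * y" .
  have "Y * R = Y * (a * y)" using ay by simp
  also have "\<dots> = Y * a * y" using Y c by (simp add: as)
  also have "\<dots> = R * R * (Y * R)" unfolding Ya using R Y by (simp add: y_def as)
  finally show ?thesis using RR by simp
qed

lemma dc_inverse_eqI:
  assumes A: "A \<in> carrier_mat n n" and Y: "Y \<in> carrier_mat n n" "A * Y = 1\<^sub>m n" "Y * A = 1\<^sub>m n"
  shows "dc_inverse A = Y"
  unfolding dc_inverse_def
proof (rule the_equality)
  fix X assume "X \<in> carrier_mat (dim_col A) (dim_row A) \<and> inverts_mat A X \<and> inverts_mat X A"
  then have X: "X \<in> carrier_mat n n" "X * A = 1\<^sub>m n" using A by (auto simp: inverts_mat_def)
  have "X = X * (A * Y)" using X Y by simp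
  also have "\<dots> = X * A * Y" by (rule assoc_mult_mat[OF X(1) A Y(1), symmetric])
  finally show "X = Y" using X Y by simp
qed (use A Y in \<open>auto simp: inverts_mat_def\<close>)

theorem theorem3p11:
  fixes A B :: "dcomplex mat" and m :: nat
  assumes "A \<in> carrier_mat m m" and "B \<in> carrier_mat m m"
    and "invertible_mat A"
    and "ndmpi B * (A * B) * dc_adjoint B = A * dc_adjoint B"
    and "B * ndmpi B * A * B = A * B"
    and "A * B * ndmpi (A * B) * B = B"
  shows "ndmpi (A * B) = dc_inverse A * ndmpi B"
proof -
  note as = assoc_mult_mat[of _ m m _ m _ m] mult_carrier_mat[of _ m m _ m]
  define C where "C = A * B"
  define N where "N = ndmpi B"
  define M where "M = ndmpi C"
  note A = assms(1) and B = assms(2)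
  have C: "C \<in> carrier_mat m m" using A B by (auto simp: C_def as)
  obtain Y where "inverts_mat A Y" "inverts_mat Y A" using assms(3) by (auto simp: invertible_mat_def)
  then have AY: "A * Y = 1\<^sub>m m" and YA': "Y * A = 1\<^sub>m (dim_row Y)" using A by (auto simp: inverts_mat_def)
  \<comment> \<open>Invertibility alone does not state the size of \<open>Y\<close>; the column
    counts of the two products give it.\<close>
  have Y: "Y \<in> carrier_mat m m"
    using arg_cong[OF AY, of dim_col] arg_cong[OF YA', of dim_col] A by auto
  have YA: "Y * A = 1\<^sub>m m" using YA' Y by simp
  have iN: "is_ndmpi B N" and iM: "is_ndmpi C M"
    unfolding N_def M_def by (auto intro: is_ndmpi_ndmpi B C)
  have N: "N \<in> carrier_mat m m" and NBN: "N * B * N = N" and hQ: "adj (B * N) = B * N" and hR: "adj (N * B) = N * B"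
    using iN B by (auto simp: is_ndmpi_def dc_adjoint_eq)
  have M: "M \<in> carrier_mat m m" and CMC: "C * M * C = essential_part C" and hP: "adj (C * M) = C * M"
    using iM C by (auto simp: is_ndmpi_def dc_adjoint_eq)
  note c = A B C Y N M adj_carrier[OF B]
  have H1: "N * C * adj B = A * adj B" using assms(4) by (simp add: N_def C_def dc_adjoint_eq)
  have "B * N * C = B * N * A * B" using c by (simp add: C_def as)
  then have H2: "B * N * C = C" using assms(5) by (simp add: N_def C_def)
  have H3: "C * M * B = B" using assms(6) by (simp add: M_def C_def)
  \<comment> \<open>Two Hermitian matrices with \<open>P Q = Q\<close> and \<open>Q P = P\<close>
    are equal, as adjoints show.\<close>
  have PQ: "C * M = B * N"
  proof -
    have "C * M * (B * N) = C * M * B * N" using c by (simp add: as)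
    then have 1: "C * M * (B * N) = B * N" using H3 by simp
    have "B * N * (C * M) = B * N * C * M" using c by (simp add: as)
    then have 2: "B * N * (C * M) = C * M" using H2 by simp
    have "C * M = adj (B * N * (C * M))" using 2 hP by simp
    also have "\<dots> = C * M * (B * N)"
      using adj_mult[of "B * N" m m "C * M" m] c hP hQ by (simp add: as del: assoc_mult_mat)
    finally show ?thesis using 1 by simp
  qed
  have eC: "essential_part C = C" using CMC H2 by (simp add: PQ)
  have BNB: "B * N * B = B" using H3 by (simp add: PQ)
  define R where "R = N * B"
  have R: "R \<in> carrier_mat m m" using c by (auto simp: R_def as)
  have BR: "B * R = B" using BNB c by (simp add: R_def as)
  have CR: "C * R = C" using BR c R by (simp add: C_def as)
  have RN: "R * N = N" using NBN by (simp add: R_def)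
  have RR: "R * R = R" using RN assoc_mult_mat[OF R N B] by (simp add: R_def)
  have Radj: "R = adj B * adj N" using hR adj_mult[OF N B] by (simp add: R_def)
  \<comment> \<open>Since \<open>C = C R\<close> and \<open>R\<close> begins with the factor
    \<open>adj B\<close>, the first hypothesis applies.\<close>
  have NC: "N * C = A * R"
  proof -
    have "N * C = N * (C * R)" using CR by simp
    also have "\<dots> = N * C * adj B * adj N" using c by (simp add: Radj as)
    also have "\<dots> = A * R" unfolding H1 Radj using c by (simp add: as)
    finally show ?thesis .
  qed
  \<comment> \<open>By \<open>NC\<close>, the columns of \<open>A * R\<close> lie in the range of
    \<open>N\<close>, which \<open>R\<close> fixes.\<close>
  have "R * (A * R) = A * R"
    using NC RN assoc_mult_mat[OF R N C] by simp
  then have YR: "R * (Y * R) = Y * R"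
    by (rule inverse_preserves_range[OF A Y R YA RR])
  define X where "X = Y * N"
  have X: "X \<in> carrier_mat m m" using c by (auto simp: X_def as)
  have XC: "X * C = R"
  proof -
    have "X * C = Y * (A * R)" using c NC by (simp add: X_def as)
    also have "\<dots> = Y * A * R" using c R by (simp add: as)
    finally show ?thesis using YA R by simp
  qed
  have RX: "R * X = X"
  proof -
    have "R * X = R * (Y * (R * N))" using RN by (simp add: X_def)
    also have "\<dots> = R * (Y * R) * N" using c R by (simp add: as)
    also have "\<dots> = Y * (R * N)" unfolding YR using c R by (simp add: as)
    finally show ?thesis using RN by (simp add: X_def)
  qed
  have CXC: "C * X * C = C"
    using XC CR assoc_mult_mat[OF C X C] by simp
  \<comment> \<open>\<open>N = N (B N) = N (C M)\<close> gives \<open>C X = C X C M\<close>, and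
    \<open>C X C = C\<close>.\<close>
  have CX: "C * X = C * M"
  proof -
    have "N * (B * N) = N" using NBN c by (simp add: as)
    then have "C * X = C * (Y * (N * (B * N)))" by (simp add: X_def)
    also have "\<dots> = C * X * (C * M)" unfolding PQ using c by (simp add: X_def as)
    also have "\<dots> = C * X * C * M" using c X by (simp add: as)
    finally show ?thesis using CXC by simp
  qed
  \<comment> \<open>Both products \<open>X C = R\<close> and \<open>C X = C M\<close> are known to
    be Hermitian, \<open>X C X = R X = X\<close>, and \<open>C X C = C\<close> is the essential
    part.\<close>
  have "is_ndmpi C X"
    using C X CXC eC XC RX CX hP hR by (auto simp: is_ndmpi_def dc_adjoint_eq R_def)
  then have "ndmpi C = X" by (rule ndmpi_eqI[OF C])
  moreover have "dc_inverse A = Y" by (rule dc_inverse_eqI[OF A Y AY YA])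
  ultimately show ?thesis by (simp add: C_def X_def N_def)
qed

end
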